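(* Let $\mathcal{P}=\{P_n:n<\omega\}$ be a partition of $\omega$ into infinitely many infinite sets such that $\min P_i<\min P_j$ whenever $i<j$. Let $\mathcal{E}^{\mathcal{P}}_\infty$ be the set of all equivalence relations $E$ on $\omega$ such that (a) $E$ has infinitely many equivalence classes, and (b) for all $k,n<\omega$, $p_k(E)\in P_n$ if and only if $n$ is the largest integer such that $2^n$ divides $k+1$. Then $(\mathcal{E}^{\mathcal{P}}_\infty,\le,r)$ is a topological Ramsey space.
   Context: For an equivalence relation $E$ on $\omega$, $(p_k(E))_{k<\omega}$ is the increasing enumeration of the set of minimal elements of its equivalence classes. For equivalence relations on the same set, $E\le F$ means every $E$-class is a union of $F$-classes. For a set $\mathcal{R}$ of equivalence relations on $\omega$ with infinitely many classes: $r_n(E)=E\restriction\{0,1,\dots,p_n(E)-1\}$; $\mathcal{AR}$ is the set of all $r_n(E)$, $E\in\mathcal{R}$; for $a\in\mathcal{AR}$, $B\in\mathcal{R}$, $[a,B]=\{A\in\mathcal{R}: A\le B,\ r_n(A)=a\text{ for some }n\}$. The Ellentuck topology on $\mathcal{R}$ is generated by the sets $[a,B]$. $\mathcal{X}\subseteq\mathcal{R}$ has the property of Baire if $\mathcal{X}=\mathcal{O}\triangle M$ with $\mathcal{O}$ Ellentuck open and $M$ Ellentuck meagre; $\mathcal{X}$ is Ramsey if for every non-empty $[a,B]$ there is $A\in[a,B]$ with $[a,A]\subseteq\mathcal{X}$ or $[a,A]\cap\mathcal{X}=\emptyset$, and Ramsey null if the second alternative can always be achieved. $(\mathcal{R},\le,r)$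 is a topological Ramsey space if a subset of $\mathcal{R}$ has the property of Baire iff it is Ramsey, and is Ellentuck meagre iff it is Ramsey null. *)

theory Defs
  imports "HOL-Analysis.Analysis" "HOL-Library.Infinite_Set" "HOL-Library.Disjoint_Sets"
    "HOL-Computational_Algebra.Factorial_Ring"
begin

text \<open>
  Equivalence relations on \<open>\<omega>\<close> are relations \<open>E\<close> with \<open>equiv UNIV E\<close>. The function
  \<open>enumerate\<close> lists an infinite set of naturals increasingly from index 0, so \<open>class_min E k\<close>
  is \<open>p\<^sub>k(E)\<close> whenever \<open>E\<close> has infinitely many classes.
\<close>

definition class_minima :: "nat rel \<Rightarrow> nat set" where
  "class_minima E = (\<lambda>C. LEAST x. x \<in> C) ` (UNIV // E)"

definition class_min :: "nat rel \<Rightarrow> nat \<Rightarrow> nat" where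
  "class_min E k = enumerate (class_minima E) k"

definition coarser :: "nat rel \<Rightarrow> nat rel \<Rightarrow> bool" where
  "coarser E F \<longleftrightarrow> (\<forall>C \<in> UNIV // E. \<exists>\<S>. \<S> \<subseteq> UNIV // F \<and> C = \<Union>\<S>)"

text \<open>
  The domain of the restriction is not recorded separately: it is the field of the restricted
  relation, because \<open>E\<close> is reflexive.
\<close>

definition approx :: "nat \<Rightarrow> nat rel \<Rightarrow> nat rel" where
  "approx n E = Restr E {..<class_min E n}"

definition approximations :: "nat rel set \<Rightarrow> nat rel set" where
  "approximations R = {approx n E | n E. E \<in> R}"

definition basic_set :: "nat rel set \<Rightarrow> nat rel \<Rightarrow> nat rel \<Rightarrow> nat rel set" where
  "basic_set R a B = {A \<in> R. coarser A B \<and> (\<exists>n. approx n A = a)}"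

definition ellentuck :: "nat rel set \<Rightarrow> nat rel topology" where
  "ellentuck R = topology_generated_by {basic_set R a B | a B. a \<in> approximations R \<and> B \<in> R}"

lemma topspace_ellentuck: "topspace (ellentuck R) = R"
proof -
  have "B \<in> basic_set R (approx 0 B) B" if "B \<in> R" for B
  proof -
    have "coarser B B"
      unfolding coarser_def by (metis bot.extremum ccpo_Sup_singleton insert_subset)
    with that show ?thesis
      unfolding basic_set_def by blast
  qed
  moreover have "approx 0 B \<in> approximations R" if "B \<in> R" for B
    using that unfolding approximations_def by blast
  moreover have "basic_set R a B \<subseteq> R" for a B
    unfolding basic_set_def by blast
  ultimately show ?thesis
    unfolding ellentuck_def topology_generated_by_topspace by blast
qed

definition nowhere_dense_in :: "'a topology \<Rightarrow> 'a set \<Rightarrow> bool" where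
  "nowhere_dense_in X S \<longleftrightarrow> S \<subseteq> topspace X \<and> X interior_of (X closure_of S) = {}"

definition meagre_in :: "'a topology \<Rightarrow> 'a set \<Rightarrow> bool" where
  "meagre_in X S \<longleftrightarrow> (\<exists>N :: nat \<Rightarrow> 'a set. (\<forall>i. nowhere_dense_in X (N i)) \<and> S = (\<Union>i. N i))"

definition baire_property_in :: "'a topology \<Rightarrow> 'a set \<Rightarrow> bool" where
  "baire_property_in X S \<longleftrightarrow> (\<exists>U M. openin X U \<and> meagre_in X M \<and> S = (U - M) \<union> (M - U))"

definition ramsey :: "nat rel set \<Rightarrow> nat rel set \<Rightarrow> bool" where
  "ramsey R \<X> \<longleftrightarrow>
     (\<forall>a \<in> approximations R. \<forall>B \<in> R. basic_set R a B \<noteq> {} \<longrightarrow>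
        (\<exists>A \<in> basic_set R a B. basic_set R a A \<subseteq> \<X> \<or> basic_set R a A \<inter> \<X> = {}))"

definition ramsey_null :: "nat rel set \<Rightarrow> nat rel set \<Rightarrow> bool" where
  "ramsey_null R \<X> \<longleftrightarrow>
     (\<forall>a \<in> approximations R. \<forall>B \<in> R. basic_set R a B \<noteq> {} \<longrightarrow>
        (\<exists>A \<in> basic_set R a B. basic_set R a A \<inter> \<X> = {}))"

definition topological_ramsey_space :: "nat rel set \<Rightarrow> bool" where
  "topological_ramsey_space R \<longleftrightarrow>
     (\<forall>\<X> \<subseteq> R. (baire_property_in (ellentuck R) \<X> \<longleftrightarrow> ramsey R \<X>) \<and>
              (meagre_in (ellentuck R) \<X> \<longleftrightarrow> ramsey_null R \<X>))"

definition E_infinity :: "(nat \<Rightarrow> nat set) \<Rightarrow> nat rel set" where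
  "E_infinity P =
     {E. equiv UNIV E \<and> infinite (UNIV // E) \<and>
         (\<forall>k n. class_min E k \<in> P n \<longleftrightarrow> n = multiplicity 2 (k + 1))}"

end

theory Submission
  imports Defs
begin

text \<open>
  Code an equivalence relation with infinitely many classes by the map \<open>f\<close> sending \<open>x\<close> to the index of
  its class, and let \<open>p\<close> enumerate the class minima. Then the relations below \<open>B\<close> are exactly those coded
  by \<open>g \<circ> f\<^sub>B\<close>, where \<open>g\<close> codes a relation whose minima \<open>q\<close> satisfy
  \<open>multiplicity 2 (q k + 1) = multiplicity 2 (k + 1)\<close>; the partition no longer matters.
  This makes the axioms of an abstract Ellentuck theorem routine, apart from the pigeonhole principle.

  The pigeonhole principle is a left-variable Hales--Jewett theorem with prescribed 2-adic lengths.
  Let \<open>M\<close> be a minimal left ideal of the compact semigroup of ultrafilters on words. There is an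
  ultrafilter \<open>u\<close> on words starting with the variable such that for every letter \<open>a\<close> the substitution \<open>u[a]\<close>
  is an idempotent of \<open>M\<close>, hence \<open>p u[a] = p\<close> for all \<open>p \<in> M\<close>. So a block chosen along \<open>u\<close> may be
  instantiated by any letter without leaving a prescribed colour. Constant words that adjust the
  length can be inserted as well, since for every \<open>m \<in> M\<close> there is \<open>y\<close> with
  \<open>p m y = p\<close> for all \<open>p \<in> M\<close>.
\<close>

subsection \<open>Ellentuck theory\<close>

text \<open>Axioms for an abstract Ellentuck theorem. \<open>approx_eqD\<close> makes the
  approximations a tree, the \<open>depth\<close> axioms express finitization,
  \<open>amalgamation\<close> and \<open>refinement\<close> together form the amalgamation axiom,
  and \<open>fusion\<close> stands in for closedness of the space. \<open>depth B a\<close> is to be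
  read as the length of the initial part of \<open>B\<close> on which \<open>a\<close>
  lives.\<close>

locale finite_approximation_space =
  fixes R :: "nat rel set"
    and depth :: "nat rel \<Rightarrow> nat rel \<Rightarrow> nat"
  assumes coarser_refl: "A \<in> R \<Longrightarrow> coarser A A"
    and coarser_trans:
      "\<lbrakk>A \<in> R; B \<in> R; C \<in> R; coarser A B; coarser B C\<rbrakk> \<Longrightarrow> coarser A C"
    and approx_eqD:
      "\<lbrakk>A \<in> R; B \<in> R; approx m A = approx n B\<rbrakk> \<Longrightarrow> m = n \<and> (\<forall>k\<le>n. approx k A = approx k B)"
    and depth_Suc:
      "\<lbrakk>A \<in> R; B \<in> R; coarser A B\<rbrakk> \<Longrightarrow> depth B (approx n A) < depth B (approx (Suc n) A)"
    and depth_mono: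
      "\<lbrakk>A \<in> R; B \<in> R; C \<in> R; coarser A B; coarser B C\<rbrakk>
        \<Longrightarrow> depth B (approx n A) \<le> depth C (approx n A)"
    and depth_eq:
      "\<lbrakk>A \<in> R; B \<in> R; C \<in> R; coarser A B; coarser B C; approx d B = approx d C;
        depth B (approx n A) = d\<rbrakk> \<Longrightarrow> depth C (approx n A) = d"
    and finite_depth:
      "B \<in> R \<Longrightarrow> finite {approx n A | n A. A \<in> R \<and> coarser A B \<and> depth B (approx n A) = d}"
    and amalgamation:
      "\<lbrakk>A \<in> R; B \<in> R; X \<in> R; coarser A B; coarser X B; depth B (approx n X) = d;
        approx d A = approx d B\<rbrakk>
        \<Longrightarrow> depth A (approx n X) = d \<and> basic_set R (approx n X) A \<noteq> {}"
    and refinement: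
      "\<lbrakk>B \<in> R; X \<in> R; coarser X B\<rbrakk>
        \<Longrightarrow> \<exists>A \<in> basic_set R (approx (depth B (approx n X)) B) B.
              basic_set R (approx n X) A \<subseteq> basic_set R (approx n X) X"
    and pigeonhole:
      "\<lbrakk>B \<in> R; X \<in> R; coarser X B\<rbrakk>
        \<Longrightarrow> \<exists>A \<in> basic_set R (approx (depth B (approx n X)) B) B.
              (\<forall>Y \<in> basic_set R (approx n X) A. approx (Suc n) Y \<in> Q) \<or>
              (\<forall>Y \<in> basic_set R (approx n X) A. approx (Suc n) Y \<notin> Q)"
    and fusion:
      "\<lbrakk>\<And>k. \<B> k \<in> R; \<And>k. coarser (\<B> (Suc k)) (\<B> k);
        \<And>k. approx (d + k) (\<B> (Suc k)) = approx (d + k) (\<B> k)\<rbrakk>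
        \<Longrightarrow> \<exists>A \<in> R. \<forall>k. coarser A (\<B> k) \<and> approx (d + k) A = approx (d + k) (\<B> k)"
begin

section \<open>Basic sets, stems and depth\<close>

abbreviation bas :: "nat rel \<Rightarrow> nat rel \<Rightarrow> nat rel set" where
  "bas \<equiv> basic_set R"

abbreviation stem :: "nat \<Rightarrow> nat rel \<Rightarrow> nat rel set" where
  "stem d B \<equiv> basic_set R (approx d B) B"

lemma basE:
  assumes "X \<in> bas a B"
  obtains n where "X \<in> R" "coarser X B" "a = approx n X"
  using assms unfolding basic_set_def by blast

lemma bas_nonemptyE:
  assumes "bas a B \<noteq> {}"
  obtains X n where "X \<in> R" "coarser X B" "a = approx n X"
  using assms unfolding basic_set_def by blast

lemma basI: "X \<in> R \<Longrightarrow> coarser X B \<Longrightarrow> a = approx n X \<Longrightarrow> X \<in> bas a B"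
  unfolding basic_set_def by blast

lemma bas_subset: "bas a B \<subseteq> R"
  unfolding basic_set_def by blast

lemma bas_self: "B \<in> R \<Longrightarrow> B \<in> stem n B"
  by (simp add: basI coarser_refl)

lemma bas_approx:
  "\<lbrakk>X \<in> R; Y \<in> bas (approx n X) B\<rbrakk> \<Longrightarrow> approx n Y = approx n X"
  by (metis approx_eqD basE)

lemma bas_mono: "\<lbrakk>A \<in> R; B \<in> R; coarser A B\<rbrakk> \<Longrightarrow> bas a A \<subseteq> bas a B"
  unfolding basic_set_def using coarser_trans by blast

lemma stemD:
  assumes "A \<in> stem d B" "B \<in> R"
  shows "A \<in> R" "coarser A B" "approx d A = approx d B"
  using assms by (auto simp: basic_set_def dest: approx_eqD)

lemma stem_trans:
  assumes "A \<in> stem d B" "B \<in> stem d C" "C \<in> R"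
  shows "A \<in> stem d C"
  using assms by (metis basI coarser_trans stemD)

lemma approx_le:
  assumes "A \<in> R" "B \<in> R" "approx n A = approx n B" "k \<le> n"
  shows "approx k A = approx k B"
  using approx_eqD assms by blast

lemma bas_longer:
  assumes "X \<in> R" "m \<le> n"
  shows "bas (approx n X) B \<subseteq> bas (approx m X) B"
  by (smt (verit) assms basE basI bas_approx approx_le subsetI)

lemma depth_less_mono:
  assumes "A \<in> R" "B \<in> R" "coarser A B"
  shows "strict_mono (\<lambda>n. depth B (approx n A))"
  using assms by (simp add: depth_Suc strict_mono_Suc_iff)

lemma stem_depth:
  assumes "A \<in> stem d B" "B \<in> R" "bas a B \<noteq> {}" "depth B a = d"
  shows "bas a A \<noteq> {}" "depth A a = d"
proof -
  from assms(3) obtain X n where X: "X \<in> R" "coarser X B" "a = approx n X"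
    by (rule bas_nonemptyE)
  with amalgamation[of A B X n d] stemD[OF assms(1,2)] assms
  show "bas a A \<noteq> {}" "depth A a = d" by auto
qed

text \<open>An arbitrary \<open>A\<close> below \<open>B\<close> may differ from \<open>B\<close>
  from the start, which fusion cannot afford. Refining along some \<open>X\<close> in
  \<open>bas a A\<close> gives an \<open>A'\<close> that agrees with \<open>B\<close> up to the
  depth of \<open>a\<close> and still satisfies \<open>bas a A' \<subseteq> bas a X\<close>.\<close>

lemma bas_refinement:
  assumes "B \<in> R" "A \<in> R" "coarser A B" "bas a A \<noteq> {}"
  obtains A' where "A' \<in> stem (depth B a) B" "bas a A' \<subseteq> bas a A"
proof -
  obtain X n where X: "X \<in> R" "coarser X A" "a = approx n X"
    using assms(4) by (rule bas_nonemptyE)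
  then have "coarser X B" using assms coarser_trans by blast
  from refinement[OF assms(1) X(1) this, of n] obtain A'
    where "A' \<in> stem (depth B a) B" "bas a A' \<subseteq> bas a X" using X by auto
  with that show ?thesis using bas_mono[of X A a] X assms by blast
qed

section \<open>Fusion\<close>

text \<open>By \<open>finite_depth\<close> only finitely many \<open>b\<close> have depth
  \<open>e\<close> in \<open>C\<close>, so they are treated one after another. Each shrinking stays
  inside \<open>stem e C\<close>; \<open>hered\<close> preserves what was achieved before, and
  \<open>depth_eq\<close> shows that no new \<open>b\<close> of depth \<open>e\<close>
  arises.\<close>

lemma fusion_step:
  assumes B: "B \<in> R" and C: "C \<in> R" "coarser C B"
    and hered: "\<And>b A A'. \<lbrakk>A \<in> R; A' \<in> R; coarser A' A; coarser A B; bas b A' \<noteq> {}; \<Phi> b A\<rbrakk> \<Longrightarrow> \<Phi> b A'"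
    and dens: "\<And>b A. \<lbrakk>A \<in> R; coarser A B; bas b A \<noteq> {}; d \<le> depth A b\<rbrakk>
       \<Longrightarrow> \<exists>A' \<in> stem (depth A b) A. \<Phi> b A'"
    and de: "d \<le> e"
  shows "\<exists>A \<in> stem e C. \<forall>b. bas b A \<noteq> {} \<and> depth A b = e \<longrightarrow> \<Phi> b A"
proof -
  let ?S = "{b. bas b C \<noteq> {} \<and> depth C b = e}"
  have "?S \<subseteq> {approx n A | n A. A \<in> R \<and> coarser A C \<and> depth C (approx n A) = e}"
    by (smt (verit, ccfv_SIG) basE ex_in_conv mem_Collect_eq subsetI)
  then have "finite ?S" using finite_depth[OF C(1)] finite_subset by blast
  have "\<exists>A \<in> stem e C. \<forall>b\<in>T. \<Phi> b A" if "T \<subseteq> ?S" "finite T" for T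
    using that(2,1)
  proof (induction T)
    case empty
    then show ?case using bas_self C by blast
  next
    case (insert b T)
    then obtain A where A: "A \<in> stem e C" "\<forall>b\<in>T. \<Phi> b A" by auto
    have b: "bas b C \<noteq> {}" "depth C b = e" using insert by auto
    have AC: "A \<in> R" "coarser A C" using stemD[OF A(1) C(1)] by auto
    have AB: "coarser A B" using AC C B coarser_trans by blast
    have "bas b A \<noteq> {}" "depth A b = e" using stem_depth[OF A(1) C(1) b] by auto
    with dens[OF AC(1) AB] de obtain A' where A': "A' \<in> stem e A" "\<Phi> b A'" by blast
    have A'C: "A' \<in> stem e C" using A' A C stem_trans by blast
    have "\<Phi> b' A'" if "b' \<in> T" for b'
    proof (rule hered[of A A' b'])
      show "A \<in> R" "A' \<in> R" "coarser A' A" using stemD[OF A'(1) AC(1)] AC by auto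
      show "coarser A B" by fact
      show "\<Phi> b' A" using A that by blast
      have "b' \<in> ?S" using that insert by blast
      then show "bas b' A' \<noteq> {}" using stem_depth[OF A'C C(1)] by blast
    qed
    then show ?case using A'(2) A'C by blast
  qed
  from this[OF subset_refl \<open>finite ?S\<close>] obtain A where A: "A \<in> stem e C" "\<forall>b\<in>?S. \<Phi> b A" by blast
  have "b \<in> ?S" if b: "bas b A \<noteq> {}" "depth A b = e" for b
  proof -
    obtain X n where "X \<in> R" "coarser X A" "b = approx n X" using b(1) by (rule bas_nonemptyE)
    then show ?thesis
      using depth_eq[of X A C e n] b stemD[OF A(1) C(1)] C bas_mono[of A C b] by auto
  qed
  with A show ?thesis by blast
qed

text \<open>\<open>fusion_step\<close> is iterated at the depths \<open>d\<close>,
  \<open>d + 1\<close> and so on. Stage \<open>k\<close> shrinks inside \<open>stem (d + k)\<close>,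
  so the stages stabilise and have a limit; \<open>hered\<close> carries the property over to
  it.\<close>

lemma fusion_all:
  assumes B: "B \<in> R"
    and hered: "\<And>b A A'. \<lbrakk>A \<in> R; A' \<in> R; coarser A' A; coarser A B; bas b A' \<noteq> {}; \<Phi> b A\<rbrakk> \<Longrightarrow> \<Phi> b A'"
    and dens: "\<And>b A. \<lbrakk>A \<in> R; coarser A B; bas b A \<noteq> {}; d \<le> depth A b\<rbrakk>
       \<Longrightarrow> \<exists>A' \<in> stem (depth A b) A. \<Phi> b A'"
  shows "\<exists>A \<in> stem d B. \<forall>b. bas b A \<noteq> {} \<and> d \<le> depth A b \<longrightarrow> \<Phi> b A"
proof -
  have "\<exists>\<B>. \<forall>k. (\<B> k \<in> R \<and> coarser (\<B> k) B \<and> (k = 0 \<longrightarrow> \<B> k = B)) \<and>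
      (\<B> (Suc k) \<in> stem (d + k) (\<B> k) \<and>
       (\<forall>b. bas b (\<B> (Suc k)) \<noteq> {} \<and> depth (\<B> (Suc k)) b = d + k \<longrightarrow> \<Phi> b (\<B> (Suc k))))"
  proof (rule dependent_nat_choice, goal_cases)
    case 1
    show ?case using B coarser_refl by auto
  next
    case (2 x k)
    then obtain A where "A \<in> stem (d + k) x"
       "\<forall>b. bas b A \<noteq> {} \<and> depth A b = d + k \<longrightarrow> \<Phi> b A"
      using fusion_step[OF B, of x \<Phi> d "d + k"] hered dens by auto
    then show ?case using 2 B by (metis coarser_trans stemD(1,2) nat.distinct(1))
  qed
  then obtain \<B> where
    R: "\<And>k. \<B> k \<in> R" and le: "\<And>k. coarser (\<B> k) B" and 0: "\<B> 0 = B"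
    and st: "\<And>k. \<B> (Suc k) \<in> stem (d + k) (\<B> k)"
    and Phi: "\<And>k b. \<lbrakk>bas b (\<B> (Suc k)) \<noteq> {}; depth (\<B> (Suc k)) b = d + k\<rbrakk> \<Longrightarrow> \<Phi> b (\<B> (Suc k))"
    by blast
  have "coarser (\<B> (Suc k)) (\<B> k)" "approx (d + k) (\<B> (Suc k)) = approx (d + k) (\<B> k)" for k
    using stemD[OF st R] by auto
  from fusion[OF R this] obtain A where A: "A \<in> R"
    "\<And>k. coarser A (\<B> k)" "\<And>k. approx (d + k) A = approx (d + k) (\<B> k)" by blast
  have "A \<in> stem d B" using A 0 by (metis add.right_neutral basI)
  moreover have "\<Phi> b A" if b: "bas b A \<noteq> {}" "d \<le> depth A b" for b
  proof -
    obtain k where k: "depth A b = d + k" using b le_Suc_ex by blast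
    obtain X n where X: "X \<in> R" "coarser X A" "b = approx n X" using b(1) by (rule bas_nonemptyE)
    \<comment> \<open>The limit agrees with stage \<open>Suc k\<close> up to \<open>d + k\<close>,
      so \<open>b\<close> has depth \<open>d + k\<close> there too and was treated at that
      stage.\<close>
    have "approx (d + k) A = approx (d + k) (\<B> (Suc k))"
      using A(3)[of "Suc k"] approx_le[OF A(1) R, of "d + Suc k" "Suc k" "d + k"] by simp
    then have "depth (\<B> (Suc k)) b = d + k"
      using depth_eq[of X A "\<B> (Suc k)" "d + k" n] X k A R by auto
    moreover have "bas b (\<B> (Suc k)) \<noteq> {}" using b bas_mono[OF A(1) R A(2)] by blast
    ultimately have "\<Phi> b (\<B> (Suc k))" using Phi by blast
    then show ?thesis using hered[OF R A(1) A(2) le b(1)] by blast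
  qed
  ultimately show ?thesis by blast
qed

section \<open>Open, nowhere dense and meagre sets in the Ellentuck topology\<close>

lemma openin_bas: "\<lbrakk>A \<in> R; bas a A \<noteq> {}\<rbrakk> \<Longrightarrow> openin (ellentuck R) (bas a A)"
  unfolding ellentuck_def approximations_def
  by (rule topology_generated_by_Basis) (auto simp: basic_set_def)

text \<open>The stems of \<open>X\<close> form a neighbourhood base at \<open>X\<close>: a basic set
  containing \<open>X\<close> with approximation \<open>a\<close> contains \<open>bas a X\<close>,
  and for an intersection the longer of the two approximations is taken.\<close>

lemma open_contains_stem:
  assumes "openin (ellentuck R) U" "X \<in> U"
  shows "\<exists>n. stem n X \<subseteq> U"
proof -
  have "generate_topology_on {bas a B |a B. a \<in> approximations R \<and> B \<in> R} U"
    using assms(1) unfolding ellentuck_def by (rule openin_topology_generated_by)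
  then show ?thesis using assms(2)
  proof (induction)
    case Empty
    then show ?case by simp
  next
    case (Int U V)
    then obtain m n where mn: "stem m X \<subseteq> U" "stem n X \<subseteq> V" by auto
    have "X \<in> R"
      using Int generate_topology_on.Int openin_subset[of "ellentuck R" U]
      unfolding topspace_ellentuck unfolding ellentuck_def
      by (auto simp: openin_topology_generated_by_iff)
    then have "stem (max m n) X \<subseteq> stem m X" "stem (max m n) X \<subseteq> stem n X"
      by (simp_all add: bas_longer)
    with mn show ?case by blast
  next
    case (UN K)
    then show ?case by blast
  next
    case (Basis S)
    then obtain a B where S: "S = bas a B" "B \<in> R" by blast
    with Basis obtain n where "X \<in> R" "coarser X B" "a = approx n X" by (auto elim: basE)
    then show ?case using S bas_mono by blast
  qed
qed

text \<open>Two fusions are made. After the first, every \<open>b\<close> is accepted or rejected;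
  after the second, rejection passes from \<open>b\<close> to its one-step extensions. If
  \<open>a\<close> is rejected, all longer approximations of a member of \<open>bas a A\<close> are
  rejected, which keeps that member out of the open set. Agreement with \<open>B\<close> up to the
  depth of \<open>a\<close> is retained so that the result can itself feed a fusion.\<close>

lemma open_strong_ramsey:
  assumes U: "openin (ellentuck R) U" and B: "B \<in> R" and a: "bas a B \<noteq> {}"
  shows "\<exists>A \<in> stem (depth B a) B. bas a A \<subseteq> U \<or> bas a A \<inter> U = {}"
proof -
  define d where "d = depth B a"
  \<comment> \<open>Combinatorial forcing: \<open>A\<close> accepts \<open>b\<close> if \<open>[b, A] \<subseteq> U\<close>.\<close>
  define rejects where "rejects A b \<longleftrightarrow>
    (\<forall>A'\<in>R. coarser A' A \<and> bas b A' \<noteq> {} \<longrightarrow> \<not> bas b A' \<subseteq> U)" for A b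
  have "\<exists>C \<in> stem d B. \<forall>b. bas b C \<noteq> {} \<and> d \<le> depth C b \<longrightarrow> bas b C \<subseteq> U \<or> rejects C b"
  proof (rule fusion_all[OF B])
    fix b A A' assume *: "A \<in> R" "A' \<in> R" "coarser A' A" "bas b A' \<noteq> {}"
      "bas b A \<subseteq> U \<or> rejects A b"
    then show "bas b A' \<subseteq> U \<or> rejects A' b"
      unfolding rejects_def using bas_mono coarser_trans by (metis subset_trans)
  next
    fix b A assume *: "A \<in> R" "coarser A B" "bas b A \<noteq> {}" "d \<le> depth A b"
    show "\<exists>A'\<in>stem (depth A b) A. bas b A' \<subseteq> U \<or> rejects A' b"
    proof (cases "rejects A b")
      case True
      then show ?thesis using * bas_self by blast
    next
      case False
      then obtain A' where "A' \<in> R" "coarser A' A" "bas b A' \<noteq> {}" "bas b A' \<subseteq> U"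
        unfolding rejects_def by blast
      then show ?thesis using bas_refinement[of A A' b] * by (metis subset_trans)
    qed
  qed
  then obtain C where C: "C \<in> stem d B" and
    dec: "\<And>b. \<lbrakk>bas b C \<noteq> {}; d \<le> depth C b\<rbrakk> \<Longrightarrow> bas b C \<subseteq> U \<or> rejects C b" by blast
  have CR: "C \<in> R" using stemD[OF C B] by auto
  have aC: "bas a C \<noteq> {}" "depth C a = d" using stem_depth[OF C B a] d_def by auto
  show ?thesis
  proof (cases "rejects C a")
    case False
    then show ?thesis using dec[of a] aC C d_def by auto
  next
    case True
    have "\<exists>A \<in> stem d C. \<forall>b. bas b A \<noteq> {} \<and> d \<le> depth A b \<longrightarrow>
       (rejects C b \<longrightarrow> (\<forall>n. \<forall>Y \<in> bas b A. b = approx n Y \<longrightarrow> rejects C (approx (Suc n) Y)))"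
    proof (rule fusion_all[OF CR])
      fix b A A' assume *: "A \<in> R" "A' \<in> R" "coarser A' A"
        "rejects C b \<longrightarrow> (\<forall>n. \<forall>Y\<in>bas b A. b = approx n Y \<longrightarrow> rejects C (approx (Suc n) Y))"
      then show "rejects C b \<longrightarrow> (\<forall>n. \<forall>Y\<in>bas b A'. b = approx n Y \<longrightarrow> rejects C (approx (Suc n) Y))"
        using bas_mono by blast
    next
      fix b A assume *: "A \<in> R" "coarser A C" "bas b A \<noteq> {}" "d \<le> depth A b"
      then obtain X n where X: "X \<in> R" "coarser X A" "b = approx n X" using bas_nonemptyE by metis
      \<comment> \<open>The pigeonhole principle is applied to the colouring of approximations by
        whether \<open>C\<close> accepts them.\<close>
      obtain A' where A': "A' \<in> stem (depth A b) A" and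
        Q: "(\<forall>Y \<in> bas b A'. approx (Suc n) Y \<in> {c. bas c C \<subseteq> U}) \<or>
            (\<forall>Y \<in> bas b A'. approx (Suc n) Y \<notin> {c. bas c C \<subseteq> U})"
        using pigeonhole[OF *(1) X(1,2), of n "{c. bas c C \<subseteq> U}"] X(3) by blast
      have A'R: "A' \<in> R" "coarser A' A" using stemD[OF A' *(1)] by auto
      have A'C: "coarser A' C" using A'R * CR coarser_trans by blast
      have "rejects C (approx (Suc m) Y)"
        if rej: "rejects C b" and Y: "Y \<in> bas b A'" "b = approx m Y" for m Y
      proof -
        have "bas b A' \<noteq> {}" using stem_depth[OF A' *(1,3)] by auto
        \<comment> \<open>If all one-step extensions were accepted, \<open>bas b A'\<close> would
          lie in \<open>U\<close>, against the rejection of \<open>b\<close>. So the other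
          alternative holds and none is accepted.\<close>
        then have "\<not> bas b A' \<subseteq> U" using rej A'R A'C unfolding rejects_def by blast
        then obtain Z where Z: "Z \<in> bas b A'" "Z \<notin> U" by blast
        have ZR: "Z \<in> R" "coarser Z A'" using Z by (auto elim: basE)
        have "Z \<in> bas (approx (Suc n) Z) C" using Z A'C A'R CR ZR by (meson basI coarser_trans)
        then have "\<forall>Y \<in> bas b A'. \<not> bas (approx (Suc n) Y) C \<subseteq> U" using Q Z by blast
        moreover have "m = n" using Y X by (metis approx_eqD basE)
        ultimately have na: "\<not> bas (approx (Suc m) Y) C \<subseteq> U" using Y by blast
        have YR: "Y \<in> R" "coarser Y A'" using Y by (auto elim: basE)
        then have YC: "coarser Y C" "coarser Y A" using A'R A'C CR * coarser_trans by blast+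
        have "d \<le> depth A b" by fact
        also have "\<dots> \<le> depth C b" using depth_mono[OF YR(1) *(1) CR YC(2) *(2)] Y by blast
        also have "\<dots> < depth C (approx (Suc m) Y)" using depth_Suc[OF YR(1) CR YC(1)] Y by blast
        finally have "d \<le> depth C (approx (Suc m) Y)" by simp
        moreover have "bas (approx (Suc m) Y) C \<noteq> {}" using YR YC basI by blast
        ultimately show ?thesis using dec na by blast
      qed
      then show "\<exists>A'\<in>stem (depth A b) A. rejects C b \<longrightarrow>
         (\<forall>n. \<forall>Y\<in>bas b A'. b = approx n Y \<longrightarrow> rejects C (approx (Suc n) Y))"
        using A' by blast
    qed
    then obtain A where A: "A \<in> stem d C" and
      rej: "\<And>b n Y. \<lbrakk>bas b A \<noteq> {}; d \<le> depth A b; rejects C b; Y \<in> bas b A; b = approx n Y\<rbrakk>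
         \<Longrightarrow> rejects C (approx (Suc n) Y)" by blast
    have AR: "A \<in> R" "coarser A C" using stemD[OF A CR] by auto
    have aA: "bas a A \<noteq> {}" "depth A a = d" using stem_depth[OF A CR aC] by auto
    have "Y \<notin> U" if Y: "Y \<in> bas a A" for Y
    proof
      assume "Y \<in> U"
      then obtain m where m: "stem m Y \<subseteq> U" using open_contains_stem U by blast
      obtain n where n: "Y \<in> R" "coarser Y A" "a = approx n Y" using Y by (auto elim: basE)
      have "rejects C (approx (n + k) Y)" for k
      proof (induction k)
        case 0
        then show ?case using n True by simp
      next
        case (Suc k)
        have "Y \<in> bas (approx (n + k) Y) A" using n basI by blast
        moreover have "d \<le> depth A (approx (n + k) Y)"
          using depth_less_mono[OF n(1) AR(1) n(2)] aA(2) n(3)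
          by (metis le_add1 strict_mono_less_eq)
        ultimately show ?case using rej Suc by fastforce
      qed
      then have "rejects C (approx (n + m) Y)" .
      moreover have "stem (n + m) Y \<subseteq> U" using bas_longer[OF n(1)] m by (meson le_add2 subset_trans)
      moreover have "coarser Y C" using n AR CR coarser_trans by blast
      ultimately show False unfolding rejects_def using n(1) bas_self by blast
    qed
    then show ?thesis using stem_trans[OF A C B] d_def by blast
  qed
qed

text \<open>The complement of the closure is open, hence strongly Ramsey. The disjoint alternative
  would put a nonempty open set inside the closure.\<close>

lemma nowhere_dense_strong:
  assumes N: "nowhere_dense_in (ellentuck R) N" and B: "B \<in> R" and a: "bas a B \<noteq> {}"
  shows "\<exists>A \<in> stem (depth B a) B. bas a A \<inter> N = {}"
proof -
  let ?U = "R - ellentuck R closure_of N"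
  have "openin (ellentuck R) ?U"
    by (metis closedin_closure_of openin_diff openin_topspace topspace_ellentuck)
  from open_strong_ramsey[OF this B a] obtain A where A: "A \<in> stem (depth B a) B"
    "bas a A \<subseteq> ?U \<or> bas a A \<inter> ?U = {}" by blast
  have AR: "A \<in> R" and ne: "bas a A \<noteq> {}" using stemD[OF A(1) B] stem_depth[OF A(1) B a] by auto
  have NR: "N \<subseteq> R" using N unfolding nowhere_dense_in_def topspace_ellentuck by auto
  then have NN: "N \<subseteq> ellentuck R closure_of N" by (simp add: closure_of_subset topspace_ellentuck)
  have "bas a A \<subseteq> ?U"
  proof (rule ccontr)
    assume "\<not> bas a A \<subseteq> ?U"
    then have "bas a A \<subseteq> ellentuck R closure_of N" using A(2) bas_subset by blast
    then have "bas a A \<subseteq> ellentuck R interior_of (ellentuck R closure_of N)"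
      by (simp add: AR ne interior_of_maximal openin_bas)
    then show False using N ne unfolding nowhere_dense_in_def by auto
  qed
  then show ?thesis using A NN by blast
qed

text \<open>Below an approximation of length \<open>n\<close> only the first \<open>n\<close>
  nowhere dense sets are avoided, which takes finitely many shrinkings. A member of
  \<open>bas a A\<close> has arbitrarily long approximations, so after fusion it avoids all of
  them.\<close>

lemma meagre_strong:
  assumes M: "meagre_in (ellentuck R) M" and B: "B \<in> R" and a: "bas a B \<noteq> {}"
  shows "\<exists>A \<in> stem (depth B a) B. bas a A \<inter> M = {}"
proof -
  obtain N :: "nat \<Rightarrow> nat rel set" where N: "\<And>i. nowhere_dense_in (ellentuck R) (N i)" "M = (\<Union>i. N i)"
    using M unfolding meagre_in_def by blast
  define d where "d = depth B a"
  have fin: "\<exists>A' \<in> stem (depth A b) A. \<forall>i<n. bas b A' \<inter> N i = {}"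
    if "A \<in> R" "bas b A \<noteq> {}" for A b and n :: nat
  proof (induction n)
    case 0
    then show ?case using that bas_self by blast
  next
    case (Suc n)
    then obtain A' where A': "A' \<in> stem (depth A b) A" "\<forall>i<n. bas b A' \<inter> N i = {}" by blast
    have A'R: "A' \<in> R" using stemD[OF A'(1) that(1)] by auto
    have ne: "bas b A' \<noteq> {}" "depth A' b = depth A b"
      using stem_depth[OF A'(1) that] by auto
    from nowhere_dense_strong[OF N(1) A'R ne(1), of n] obtain A'' where
      A'': "A'' \<in> stem (depth A b) A'" "bas b A'' \<inter> N n = {}" using ne by auto
    have "bas b A'' \<subseteq> bas b A'" using bas_mono stemD[OF A''(1) A'R] A'R by blast
    then have "\<forall>i<Suc n. bas b A'' \<inter> N i = {}" using A'(2) A''(2) by (auto simp: less_Suc_eq)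
    then show ?case using stem_trans[OF A''(1) A'(1) that(1)] by blast
  qed
  have "\<exists>A \<in> stem d B. \<forall>b. bas b A \<noteq> {} \<and> d \<le> depth A b \<longrightarrow>
     (\<forall>n. \<forall>Y \<in> bas b A. b = approx n Y \<longrightarrow> (\<forall>i<n. Y \<notin> N i))"
  proof (rule fusion_all[OF B])
    fix b A A' assume *: "A \<in> R" "A' \<in> R" "coarser A' A"
      "\<forall>n. \<forall>Y\<in>bas b A. b = approx n Y \<longrightarrow> (\<forall>i<n. Y \<notin> N i)"
    then show "\<forall>n. \<forall>Y\<in>bas b A'. b = approx n Y \<longrightarrow> (\<forall>i<n. Y \<notin> N i)"
      using bas_mono by blast
  next
    fix b A assume *: "A \<in> R" "bas b A \<noteq> {}"
    then obtain X n where X: "X \<in> R" "b = approx n X" using bas_nonemptyE by metis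
    obtain A' where A': "A' \<in> stem (depth A b) A" "\<forall>i<n. bas b A' \<inter> N i = {}"
      using fin * by blast
    have "m = n" if "Y \<in> bas b A'" "b = approx m Y" for m Y
      using that X approx_eqD basE by metis
    then show "\<exists>A' \<in> stem (depth A b) A. \<forall>n. \<forall>Y\<in>bas b A'. b = approx n Y \<longrightarrow> (\<forall>i<n. Y \<notin> N i)"
      using A' by blast
  qed
  then obtain A where A: "A \<in> stem d B" and
    *: "\<forall>b. bas b A \<noteq> {} \<and> d \<le> depth A b \<longrightarrow>
      (\<forall>n. \<forall>Y \<in> bas b A. b = approx n Y \<longrightarrow> (\<forall>i<n. Y \<notin> N i))" ..
  have AR: "A \<in> R" "depth A a = d" using stemD[OF A B] stem_depth[OF A B a] d_def by auto
  have "Y \<notin> N i" if Y: "Y \<in> bas a A" for Y i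
  proof -
    obtain n where n: "Y \<in> R" "coarser Y A" "a = approx n Y" using Y by (auto elim: basE)
    have "d \<le> depth A (approx (n + Suc i) Y)"
      using depth_less_mono[OF n(1) AR(1) n(2)] AR(2) n(3) by (metis le_add1 strict_mono_less_eq)
    moreover have "Y \<in> bas (approx (n + Suc i) Y) A" using n basI by blast
    ultimately show ?thesis using *[rule_format, of "approx (n + Suc i) Y" Y "n + Suc i" i] by auto
  qed
  then show ?thesis using A N d_def by blast
qed

text \<open>The strong form yields an \<open>A\<close> that agrees with \<open>B\<close>, not with
  \<open>a\<close>, and so need not belong to \<open>bas a B\<close>. Any \<open>C\<close> in
  \<open>bas a A\<close> does.\<close>

lemma strong_imp_weak:
  assumes "A \<in> stem (depth B a) B" "B \<in> R" "bas a B \<noteq> {}"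
  shows "\<exists>C \<in> bas a B. bas a C \<subseteq> bas a A"
proof -
  have A: "A \<in> R" "coarser A B" using stemD assms by blast+
  obtain C where C: "C \<in> bas a A" using stem_depth assms by blast
  then have "C \<in> R" "coarser C A" by (auto elim: basE)
  then show ?thesis using C bas_mono[OF A(1) assms(2) A(2)] bas_mono[of C A a] A by blast
qed

text \<open>If the closure of \<open>X\<close> contained \<open>stem n Y\<close>, nullness would
  provide a point \<open>A\<close> of that stem with a neighbourhood missing
  \<open>X\<close>.\<close>

lemma ramsey_null_imp_nowhere_dense:
  assumes X: "X \<subseteq> R" and null: "ramsey_null R X"
  shows "nowhere_dense_in (ellentuck R) X"
  unfolding nowhere_dense_in_def topspace_ellentuck
proof (intro conjI X equals0I)
  fix Y assume "Y \<in> ellentuck R interior_of (ellentuck R closure_of X)"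
  then obtain n where n: "stem n Y \<subseteq> ellentuck R closure_of X" and YR: "Y \<in> R"
    using open_contains_stem[OF openin_interior_of] interior_of_subset
    by (metis (no_types, opaque_lifting) in_mono interior_of_subset_topspace subset_trans topspace_ellentuck)
  obtain A where A: "A \<in> stem n Y" "bas (approx n Y) A \<inter> X = {}"
    using null YR bas_self unfolding ramsey_null_def approximations_def by blast
  have AR: "A \<in> R" "coarser A Y" "approx n A = approx n Y" using stemD[OF A(1) YR] by auto
  then have "A \<in> bas (approx n Y) A" using bas_self by metis
  moreover have "A \<in> ellentuck R closure_of X" using n A by blast
  ultimately show False
    using openin_bas[OF AR(1)] A(2) unfolding in_closure_of by blast
qed

theorem topological_ramsey: "topological_ramsey_space R"
proof -
  have null: "meagre_in (ellentuck R) X \<longleftrightarrow> ramsey_null R X" if X: "X \<subseteq> R" for X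
  proof
    assume "meagre_in (ellentuck R) X"
    then show "ramsey_null R X"
      unfolding ramsey_null_def by (metis (no_types, lifting) Int_mono meagre_strong strong_imp_weak subset_empty subset_refl)
  next
    assume "ramsey_null R X"
    then have "nowhere_dense_in (ellentuck R) X" using ramsey_null_imp_nowhere_dense X by blast
    then show "meagre_in (ellentuck R) X" unfolding meagre_in_def by (intro exI[of _ "\<lambda>_. X"]) auto
  qed
  have "baire_property_in (ellentuck R) X \<longleftrightarrow> ramsey R X" if X: "X \<subseteq> R" for X
  proof
    assume "baire_property_in (ellentuck R) X"
    then obtain U M where U: "openin (ellentuck R) U" and M: "meagre_in (ellentuck R) M"
      and XU: "X = (U - M) \<union> (M - U)" unfolding baire_property_in_def by blast
    show "ramsey R X" unfolding ramsey_def
    proof (intro ballI impI)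
      fix a B assume B: "B \<in> R" and a: "bas a B \<noteq> {}"
      obtain A where A: "A \<in> stem (depth B a) B" "bas a A \<inter> M = {}" using meagre_strong[OF M B a] by blast
      have AR: "A \<in> R" "bas a A \<noteq> {}" "depth A a = depth B a"
        using stemD[OF A(1) B] stem_depth[OF A(1) B a] by auto
      obtain C where C: "C \<in> stem (depth B a) A" "bas a C \<subseteq> U \<or> bas a C \<inter> U = {}"
        using open_strong_ramsey[OF U AR(1,2)] AR(3) by auto
      have "bas a C \<subseteq> bas a A" using bas_mono stemD[OF C(1) AR(1)] AR by blast
      then have "bas a C \<subseteq> X \<or> bas a C \<inter> X = {}" using C A XU by blast
      moreover obtain D where "D \<in> bas a B" "bas a D \<subseteq> bas a C"
        using strong_imp_weak[OF stem_trans[OF C(1) A(1) B] B a] by blast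
      ultimately show "\<exists>A\<in>bas a B. bas a A \<subseteq> X \<or> bas a A \<inter> X = {}" by blast
    qed
  next
    assume ram: "ramsey R X"
    let ?U = "ellentuck R interior_of X"
    \<comment> \<open>On \<open>bas a A\<close> either \<open>X\<close> is everything, and then this
      open set lies in the interior, or \<open>X\<close> is empty. In both cases it misses the
      difference.\<close>
    have "ramsey_null R (X - ?U)" unfolding ramsey_null_def
    proof (intro ballI impI)
      fix a B assume B: "a \<in> approximations R" "B \<in> R" and a: "bas a B \<noteq> {}"
      then obtain A where A: "A \<in> bas a B" "bas a A \<subseteq> X \<or> bas a A \<inter> X = {}"
        using ram unfolding ramsey_def by blast
      obtain n where AR: "A \<in> R" and "a = approx n A" using A(1) by (auto elim!: basE)
      then have ne: "bas a A \<noteq> {}" using bas_self by blast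
      have "bas a A \<subseteq> ?U" if "bas a A \<subseteq> X" using that openin_bas[OF AR ne] by (simp add: interior_of_maximal)
      then show "\<exists>A\<in>bas a B. bas a A \<inter> (X - ?U) = {}" using A by blast
    qed
    then have "meagre_in (ellentuck R) (X - ?U)" using null X by blast
    moreover have "X = (?U - (X - ?U)) \<union> ((X - ?U) - ?U)" using interior_of_subset[of "ellentuck R" X] by blast
    ultimately show "baire_property_in (ellentuck R) X"
      unfolding baire_property_in_def using openin_interior_of by blast
  qed
  with null show ?thesis unfolding topological_ramsey_space_def by blast
qed

end

subsection \<open>Ultrafilters on words\<close>

lemma compact_imp_closed_fun:
  fixes K :: "('a \<Rightarrow> 'b::t2_space) set"
  assumes "compact K"
  shows "closed K"
proof -
  have "Hausdorff_space (euclidean :: ('a \<Rightarrow> 'b) topology)"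
    unfolding euclidean_product_topology[symmetric] Hausdorff_space_product_topology
    by (simp add: Hausdorff_space_def disjnt_def) (metis hausdorff)
  then show ?thesis
    using assms compactin_imp_closedin[of euclidean K] by simp
qed

lemma compact_UNIV_fun:
  assumes "compact (UNIV :: 'b::topological_space set)"
  shows "compact (UNIV :: ('a \<Rightarrow> 'b) set)"
  using assms compactin_PiE[of "\<lambda>_. euclidean" "UNIV :: 'a set" "\<lambda>_. UNIV :: 'b set"]
  by (simp add: euclidean_product_topology)

text \<open>Zorn's lemma is applied to complements, ordered by inclusion. The intersection of a
  chain of compact sets is nonempty by the finite intersection property, because a finite subfamily
  has its smallest member as intersection.\<close>

lemma minimal_compact:
  fixes K :: "'a::topological_space set"
  assumes compact_closed: "\<And>L :: 'a set. compact L \<Longrightarrow> closed L"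
    and K: "compact K" "K \<noteq> {}" "P K"
    and Inter: "\<And>\<C>. \<C> \<noteq> {} \<Longrightarrow> (\<And>L. L \<in> \<C> \<Longrightarrow> P L) \<Longrightarrow> P (\<Inter>\<C>)"
  obtains M where "compact M" "M \<noteq> {}" "P M" "M \<subseteq> K"
    "\<And>L. \<lbrakk>compact L; L \<noteq> {}; P L; L \<subseteq> M\<rbrakk> \<Longrightarrow> L = M"
proof -
  define \<A> where "\<A> = {S. compact (- S) \<and> - S \<noteq> {} \<and> P (- S) \<and> - S \<subseteq> K}"
  have "\<exists>M\<in>\<A>. \<forall>X\<in>\<A>. M \<subseteq> X \<longrightarrow> X = M"
  proof (rule subset_Zorn_nonempty)
    show "\<A> \<noteq> {}" using K unfolding \<A>_def by (auto intro!: exI[of _ "- K"])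
  next
    fix \<C> assume ne: "\<C> \<noteq> {}" and ch: "subset.chain \<A> \<C>"
    then have sub: "\<And>S. S \<in> \<C> \<Longrightarrow> S \<in> \<A>" unfolding subset.chain_def by blast
    let ?D = "uminus ` \<C>"
    have eq: "- \<Union>\<C> = \<Inter>?D" by auto
    have cl: "closed T" if "T \<in> ?D" for T using that sub unfolding \<A>_def by (auto intro: compact_closed)
    have "K \<inter> \<Inter>?D \<noteq> {}"
    proof (rule compact_imp_fip[OF K(1) cl])
      fix F assume F: "finite F" "F \<subseteq> ?D"
      show "K \<inter> \<Inter>F \<noteq> {}"
      proof (cases "F = {}")
        case True
        then show ?thesis using K by auto
      next
        case False
        have "\<Inter>F \<in> F"
          using F(1) False F(2)
        proof (induction rule: finite_ne_induct)
          case (singleton T)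
          then show ?case by simp
        next
          case (insert T F)
          then have "\<Inter>F \<in> ?D" "T \<in> ?D" by blast+
          then obtain S S' where S: "S \<in> \<C>" "S' \<in> \<C>" "T = - S" "\<Inter>F = - S'"
            unfolding image_iff by blast
          then have "S \<subseteq> S' \<or> S' \<subseteq> S" using ch unfolding subset.chain_def subset_iff_psubset_eq by blast
          then have "\<Inter>(insert T F) = T \<or> \<Inter>(insert T F) = \<Inter>F" using S by auto
          then show ?case using insert by (metis insertCI subset_insertI subsetD insert_subset)
        qed
        then obtain S where "S \<in> \<C>" "\<Inter>F = - S" using F by blast
        then show ?thesis using sub unfolding \<A>_def by blast
      qed
    qed
    moreover have "\<Inter>?D \<subseteq> K" using ne sub unfolding \<A>_def by blast
    moreover have "closed (\<Inter>?D)" using cl by blast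
    then have "compact (\<Inter>?D)"
      using \<open>\<Inter>?D \<subseteq> K\<close> K(1) by (metis compact_Int_closed inf.absorb_iff2)
    moreover have "P (\<Inter>?D)" using Inter[of ?D] ne sub unfolding \<A>_def by blast
    ultimately show "\<Union>\<C> \<in> \<A>" unfolding \<A>_def mem_Collect_eq eq by blast
  qed
  then obtain S where S: "S \<in> \<A>" "\<And>X. X \<in> \<A> \<Longrightarrow> S \<subseteq> X \<Longrightarrow> X = S" by blast
  show ?thesis
  proof (rule that[of "- S"])
    fix L assume "compact L" "L \<noteq> {}" "P L" "L \<subseteq> - S"
    then have "- L \<in> \<A>" "S \<subseteq> - L" using S(1) unfolding \<A>_def by auto
    then show "L = - S" using S(2) by blast
  qed (use S(1) in \<open>auto simp: \<A>_def\<close>)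
qed

section \<open>Compact right topological semigroups\<close>

locale right_topological_semigroup =
  fixes mult :: "'a::topological_space \<Rightarrow> 'a \<Rightarrow> 'a" (infixl "\<otimes>" 70)
  assumes assoc: "(x \<otimes> y) \<otimes> z = x \<otimes> (y \<otimes> z)"
    and compact_closed: "\<And>L :: 'a set. compact L \<Longrightarrow> closed L"
    and continuous_mult: "continuous_on UNIV (\<lambda>x. x \<otimes> y)"
begin

lemma compact_right_translate: "compact K \<Longrightarrow> compact ((\<lambda>x. x \<otimes> y) ` K)"
  using continuous_mult compact_continuous_image continuous_on_subset by blast

text \<open>The Ellis-Numakura lemma. In a minimal compact subsemigroup \<open>M\<close> each
  \<open>e\<close> satisfies \<open>M e = M\<close>, so the solutions \<open>y\<close> of
  \<open>y e = e\<close> form a nonempty compact subsemigroup. It must be all of \<open>M\<close>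
  and thus contains \<open>e\<close>.\<close>

lemma idempotent_exists:
  assumes K: "compact K" "K \<noteq> {}" and closed: "\<And>x y. x \<in> K \<Longrightarrow> y \<in> K \<Longrightarrow> x \<otimes> y \<in> K"
  obtains e where "e \<in> K" "e \<otimes> e = e"
proof -
  let ?P = "\<lambda>K. \<forall>x\<in>K. \<forall>y\<in>K. x \<otimes> y \<in> K"
  obtain M where M: "compact M" "M \<noteq> {}" "?P M" "M \<subseteq> K"
    and min: "\<And>L. \<lbrakk>compact L; L \<noteq> {}; ?P L; L \<subseteq> M\<rbrakk> \<Longrightarrow> L = M"
  proof (rule minimal_compact[of K ?P, OF compact_closed])
    show "?P K" using closed by blast
  qed (use K in blast)+
  obtain e where e: "e \<in> M" using M by blast
  have "(\<lambda>x. x \<otimes> e) ` M = M"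
  proof (rule min)
    show "?P ((\<lambda>x. x \<otimes> e) ` M)"
      using M(3) e by (auto simp: image_iff) (metis assoc)
  qed (use M e compact_right_translate in auto)
  then obtain y where y: "y \<in> M" "y \<otimes> e = e" using e by force
  let ?L = "{y \<in> M. y \<otimes> e = e}"
  have "closed ((\<lambda>x. x \<otimes> e) -` {e})"
    using continuous_mult compact_closed[of "{e}"] continuous_on_closed_vimage[of UNIV] by auto
  then have "compact (M \<inter> (\<lambda>x. x \<otimes> e) -` {e})" using M(1) by blast
  moreover have "M \<inter> (\<lambda>x. x \<otimes> e) -` {e} = ?L" by auto
  ultimately have "compact ?L" by simp
  moreover have "?P ?L" using M(3) assoc by auto
  ultimately have "?L = M" using min[of ?L] y by blast
  then show ?thesis using that e M by blast
qed

text \<open>For \<open>m\<close> in a minimal compact left ideal \<open>M\<close>, the translate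
  \<open>M m\<close> is again a compact left ideal contained in \<open>M\<close>, hence equal to
  \<open>M\<close>.\<close>

lemma minimal_left_ideal_exists:
  assumes K: "compact K" "K \<noteq> {}" and closed: "\<And>x y. x \<in> K \<Longrightarrow> y \<in> K \<Longrightarrow> x \<otimes> y \<in> K"
  obtains M where "M \<subseteq> K" "compact M" "M \<noteq> {}" "\<And>x m. x \<in> K \<Longrightarrow> m \<in> M \<Longrightarrow> x \<otimes> m \<in> M"
    "\<And>m. m \<in> M \<Longrightarrow> (\<lambda>x. x \<otimes> m) ` M = M"
proof -
  let ?P = "\<lambda>L. \<forall>x\<in>K. \<forall>y\<in>L. x \<otimes> y \<in> L"
  obtain M where M: "compact M" "M \<noteq> {}" "?P M" "M \<subseteq> K"
    and min: "\<And>L. \<lbrakk>compact L; L \<noteq> {}; ?P L; L \<subseteq> M\<rbrakk> \<Longrightarrow> L = M"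
  proof (rule minimal_compact[of K ?P, OF compact_closed])
    show "?P K" using closed by blast
    show "?P (\<Inter>\<C>)" if "\<And>L. L \<in> \<C> \<Longrightarrow> ?P L" for \<C>
      using that by (intro ballI InterI) (metis InterD)
  qed (use K in auto)
  have "(\<lambda>x. x \<otimes> m) ` M = M" if m: "m \<in> M" for m
  proof (rule min)
    show "?P ((\<lambda>x. x \<otimes> m) ` M)"
      using M(3) by (auto simp: image_iff) (metis assoc)
  qed (use M m compact_right_translate in auto)
  then show ?thesis using that[of M] M by auto
qed

text \<open>Each \<open>p \<otimes> M\<close> with \<open>p \<in> M\<close> is a group.\<close>

lemma minimal_left_ideal_right_identity:
  assumes onto: "\<And>m. m \<in> M \<Longrightarrow> (\<lambda>x. x \<otimes> m) ` M = M"
    and e: "e \<in> M" "e \<otimes> e = e" and p: "p \<in> M"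
  shows "p \<otimes> e = p"
proof -
  obtain q where "p = q \<otimes> e" using onto[OF e(1)] p by blast
  then show ?thesis using e(2) by (simp add: assoc)
qed

text \<open>The required \<open>y\<close> is the inverse of \<open>e m\<close> in the group
  \<open>e M\<close>. Since \<open>e\<close> is a right identity of \<open>M\<close>, this one
  element works for every \<open>p\<close>.\<close>

lemma minimal_left_ideal_cancel:
  assumes closed: "\<And>x y. x \<in> M \<Longrightarrow> y \<in> M \<Longrightarrow> x \<otimes> y \<in> M"
    and onto: "\<And>m. m \<in> M \<Longrightarrow> (\<lambda>x. x \<otimes> m) ` M = M"
    and e: "e \<in> M" "e \<otimes> e = e" and m: "m \<in> M"
  shows "\<exists>y\<in>M. \<forall>p\<in>M. (p \<otimes> m) \<otimes> y = p"
proof -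
  have right_id: "p \<otimes> e = p" if "p \<in> M" for p
    using onto e that by (rule minimal_left_ideal_right_identity)
  define x where "x = e \<otimes> m"
  have x: "x \<in> M" "e \<otimes> x = x" using e m closed assoc unfolding x_def by metis+
  obtain y0 where y0: "y0 \<in> M" "y0 \<otimes> x = e" using onto[OF x(1)] e by (metis image_iff)
  define y where "y = e \<otimes> y0"
  have y: "y \<in> M" "y \<otimes> x = e" using e y0 closed assoc unfolding y_def by metis+
  obtain z0 where z0: "z0 \<in> M" "z0 \<otimes> y = e" using onto[OF y(1)] e by (metis image_iff)
  define z where "z = e \<otimes> z0"
  have z: "z \<in> M" "z \<otimes> y = e" using e z0 closed assoc unfolding z_def by metis+
  \<comment> \<open>A left inverse of a left inverse:
    \<open>x = e x = z y x = z e = z\<close>.\<close>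
  have "x = z"
    using x z y assoc right_id[OF z(1)] by metis
  then have xy: "x \<otimes> y = e" using z by simp
  have "(p \<otimes> m) \<otimes> y = p" if "p \<in> M" for p
  proof -
    have "(p \<otimes> m) \<otimes> y = ((p \<otimes> e) \<otimes> m) \<otimes> y" using right_id[OF that] by simp
    also have "\<dots> = p \<otimes> (x \<otimes> y)" unfolding x_def by (simp add: assoc)
    finally show ?thesis using xy right_id[OF that] by simp
  qed
  then show "\<exists>y\<in>M. \<forall>p\<in>M. (p \<otimes> m) \<otimes> y = p" using y by blast
qed

end

text \<open>An ultrafilter is represented by the truth value that it assigns to each predicate.\<close>

definition ultra :: "(('a \<Rightarrow> bool) \<Rightarrow> bool) \<Rightarrow> bool" where
  "ultra p \<longleftrightarrow> (\<forall>P Q. p (\<lambda>x. P x \<and> Q x) \<longleftrightarrow> p P \<and> p Q) \<and> (\<forall>P. p (\<lambda>x. \<not> P x) \<longleftrightarrow> \<not> p P)"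

definition push :: "('a \<Rightarrow> 'b) \<Rightarrow> (('a \<Rightarrow> bool) \<Rightarrow> bool) \<Rightarrow> ('b \<Rightarrow> bool) \<Rightarrow> bool" where
  "push f p = (\<lambda>P. p (\<lambda>x. P (f x)))"

text \<open>Concatenation extended to ultrafilters. With this order of quantification the product is
  continuous in its left factor.\<close>

definition uprod :: "(('a list \<Rightarrow> bool) \<Rightarrow> bool) \<Rightarrow> (('a list \<Rightarrow> bool) \<Rightarrow> bool) \<Rightarrow>
    ('a list \<Rightarrow> bool) \<Rightarrow> bool" (infixl "\<odot>" 70) where
  "p \<odot> q = (\<lambda>P. p (\<lambda>s. q (\<lambda>t. P (s @ t))))"

lemma
  assumes "ultra p"
  shows ultra_conj: "p (\<lambda>x. P x \<and> Q x) \<longleftrightarrow> p P \<and> p Q"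
    and ultra_not: "p (\<lambda>x. \<not> P x) \<longleftrightarrow> \<not> p P"
  using assms unfolding ultra_def by blast+

lemma ultra_False:
  assumes "ultra p"
  shows "\<not> p (\<lambda>x. False)"
  using ultra_conj[OF assms, of "\<lambda>x. True" "\<lambda>x. \<not> True"] ultra_not[OF assms, of "\<lambda>x. True"] by auto

lemma ultra_True: "ultra p \<Longrightarrow> p (\<lambda>x. True)"
  using ultra_not[of p "\<lambda>x. False"] ultra_False by simp

lemma ultra_mono:
  assumes "ultra p" "p P" "\<And>x. P x \<Longrightarrow> Q x"
  shows "p Q"
proof -
  have "(\<lambda>x. P x \<and> Q x) = P" using assms(3) by auto
  then show ?thesis using ultra_conj[OF assms(1), of P Q] assms(2) by simp
qed

lemma ultra_witness:
  assumes "ultra p" "p P"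
  obtains x where "P x"
  using assms ultra_mono ultra_False by metis

lemma ultra_finite_ball:
  assumes "ultra p" "finite I" "\<And>i. i \<in> I \<Longrightarrow> p (P i)"
  shows "p (\<lambda>x. \<forall>i\<in>I. P i x)"
  using assms(2,3)
proof (induction I)
  case empty
  then show ?case using ultra_True[OF assms(1)] by simp
next
  case (insert i I)
  then show ?case using ultra_conj[OF assms(1), of "P i" "\<lambda>x. \<forall>i\<in>I. P i x"] by simp
qed

lemma ultra_finite_bex:
  assumes "ultra p" "finite I" "p (\<lambda>x. \<exists>i\<in>I. P i x)"
  shows "\<exists>i\<in>I. p (P i)"
proof (rule ccontr)
  assume neg: "\<not> ?thesis"
  have "p (\<lambda>x. \<forall>i\<in>I. \<not> P i x)"
  proof (rule ultra_finite_ball[OF assms(1,2)])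
    fix i assume "i \<in> I"
    then show "p (\<lambda>x. \<not> P i x)"
      using neg ultra_not[OF assms(1), of "P i"] by blast
  qed
  then show False using assms(3) ultra_not[OF assms(1), of "\<lambda>x. \<exists>i\<in>I. P i x"] by simp
qed

lemma ultra_push: "ultra p \<Longrightarrow> ultra (push f p)"
  by (simp add: ultra_def push_def)

lemma ultra_uprod: "ultra p \<Longrightarrow> ultra q \<Longrightarrow> ultra (p \<odot> q)"
  by (simp add: ultra_def uprod_def)

lemma ultra_principal: "ultra (\<lambda>P. P x)"
  by (simp add: ultra_def)

lemma push_uprod:
  assumes "\<And>s t. f (s @ t) = f s @ f t"
  shows "push f (p \<odot> q) = push f p \<odot> push f q"
  by (simp add: push_def uprod_def assms)

lemma push_push: "push f (push g p) = push (\<lambda>x. f (g x)) p"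
  by (simp add: push_def)

interpretation uprod: right_topological_semigroup uprod
proof
  show "(x \<odot> y) \<odot> z = x \<odot> (y \<odot> z)" for x y z :: "('a list \<Rightarrow> bool) \<Rightarrow> bool"
    by (simp add: uprod_def)
  show "closed L" if "compact L" for L :: "(('a list \<Rightarrow> bool) \<Rightarrow> bool) set"
    using that by (rule compact_imp_closed_fun)
  show "continuous_on UNIV (\<lambda>x. x \<odot> y)" for y :: "('a list \<Rightarrow> bool) \<Rightarrow> bool"
    unfolding uprod_def
    by (rule continuous_on_coordinatewise_then_product) (rule continuous_on_product_coordinates)
qed

text \<open>Each clause of \<open>ultra\<close> tests at most three coordinates of \<open>p\<close>,
  so it defines a closed subset of a product of two-point spaces.\<close>

lemma compact_ultra: "compact {p. ultra p \<and> p P}"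
proof -
  have op: "open {p. p A = b}" for A :: "'a \<Rightarrow> bool" and b :: bool
    using product_topology_basis'[of "{()}" "\<lambda>_. {b}" "\<lambda>_. A"] open_discrete[of "{b}"] by simp
  have eq: "closed {p. p A = b}" for A :: "'a \<Rightarrow> bool" and b :: bool
  proof -
    have "- {p. p A = b} = {p. p A = (\<not> b)}" by auto
    then show ?thesis using op[of A "\<not> b"] unfolding closed_def by simp
  qed
  have cl: "closed {p. \<phi> (p A) (p B) (p D)}" for A B D :: "'a \<Rightarrow> bool" and \<phi> :: "bool \<Rightarrow> bool \<Rightarrow> bool \<Rightarrow> bool"
  proof -
    have "{p. \<phi> (p A) (p B) (p D)} = (\<Union>(a, b, d) \<in> {(a, b, d). \<phi> a b d}.
       {p. p A = a} \<inter> {p. p B = b} \<inter> {p. p D = d})" by auto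
    moreover have "closed \<dots>"
      by (intro closed_UN) (auto intro!: closed_Int eq)
    ultimately show ?thesis by simp
  qed
  have "closed {p :: ('a \<Rightarrow> bool) \<Rightarrow> bool. ultra p \<and> p P}"
    unfolding ultra_def
    by (intro closed_Collect_conj closed_Collect_all
         cl[of "\<lambda>a b d. a \<longleftrightarrow> b \<and> d"] cl[of "\<lambda>a b d. a \<longleftrightarrow> \<not> b"] cl[of "\<lambda>a b d. a"])
  moreover have "compact (UNIV :: (('a \<Rightarrow> bool) \<Rightarrow> bool) set)"
    by (intro compact_UNIV_fun finite_imp_compact) simp
  ultimately show ?thesis
    using compact_Int_closed by (metis inf_top_left)
qed

text \<open>Variable words have letters in an option type, with \<open>None\<close> as the variable.\<close>

definition inst :: "'a \<Rightarrow> 'a option list \<Rightarrow> 'a list" where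
  "inst a = map (case_option a id)"

lemma inst_append: "inst a (s @ t) = inst a s @ inst a t"
  by (simp add: inst_def)

lemma inst_map_Some: "inst a (map Some t) = t"
  by (simp add: inst_def o_def)

lemma length_inst: "length (inst a s) = length s"
  by (simp add: inst_def)

text \<open>\<open>u\<close> is an idempotent in a compact semigroup of ultrafilters on words headed
  by the variable. Substitution commutes with concatenation, so its instances are idempotents as
  well; being in \<open>M\<close>, they are right identities of \<open>M\<close>.\<close>

lemma left_variable_ultrafilter:
  obtains M :: "(('a list \<Rightarrow> bool) \<Rightarrow> bool) set" and u :: "('a option list \<Rightarrow> bool) \<Rightarrow> bool"
  where "M \<noteq> {}" "\<And>p. p \<in> M \<Longrightarrow> ultra p" "\<And>p m. ultra p \<Longrightarrow> m \<in> M \<Longrightarrow> p \<odot> m \<in> M"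
    "ultra u" "u (\<lambda>x. \<exists>x'. x = None # x')" "\<And>a. push (inst a) u \<in> M"
    "\<And>a p. p \<in> M \<Longrightarrow> p \<odot> push (inst a) u = p"
    "\<And>m. m \<in> M \<Longrightarrow> \<exists>y\<in>M. \<forall>p\<in>M. (p \<odot> m) \<odot> y = p"
proof -
  let ?U = "{p :: ('a list \<Rightarrow> bool) \<Rightarrow> bool. ultra p}"
  have "?U = {p. ultra p \<and> p (\<lambda>x. True)}" using ultra_True by blast
  then have cU: "compact ?U" using compact_ultra[of "\<lambda>x. True"] by simp
  have "(\<lambda>P. P []) \<in> ?U" by (simp add: ultra_principal)
  then have neU: "?U \<noteq> {}" by blast
  obtain M where M: "M \<subseteq> ?U" "M \<noteq> {}"
    "\<And>x m. x \<in> ?U \<Longrightarrow> m \<in> M \<Longrightarrow> x \<odot> m \<in> M"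
    "\<And>m. m \<in> M \<Longrightarrow> (\<lambda>x. x \<odot> m) ` M = M"
  proof (rule uprod.minimal_left_ideal_exists[OF cU neU])
    show "x \<odot> y \<in> ?U" if "x \<in> ?U" "y \<in> ?U" for x y using that ultra_uprod by blast
  qed (rule that)
  obtain w where w: "w \<in> M" using M by blast
  let ?w = "push (map Some) w"
  let ?L = "{x. ultra x \<and> x (\<lambda>x. \<exists>x' :: 'a option list. x = None # x')}"
  \<comment> \<open>Multiplying by \<open>w\<close> on the right makes every substitution instance land in \<open>M\<close>.\<close>
  let ?K = "(\<lambda>x. x \<odot> ?w) ` ?L"
  have uw: "ultra ?w" using w M ultra_push by blast
  have L: "x \<odot> y \<in> ?L" if "x \<in> ?L" "ultra y" for x y
  proof -
    have "(x \<odot> y) (\<lambda>x. \<exists>x'. x = None # x')"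
      unfolding uprod_def using that(1)
    proof (elim CollectE conjE ultra_mono)
      fix s :: "'a option list" assume "\<exists>x'. s = None # x'"
      then show "y (\<lambda>t. \<exists>x'. s @ t = None # x')" using ultra_True[OF that(2)] by auto
    qed
    then show ?thesis using that ultra_uprod by blast
  qed
  obtain u where u: "u \<in> ?K" "u \<odot> u = u"
  proof (rule uprod.idempotent_exists[of ?K])
    show "compact ?K" using uprod.compact_right_translate compact_ultra by blast
    show "?K \<noteq> {}" using ultra_principal[of "[None]"] by auto
    fix x y assume "x \<in> ?K" "y \<in> ?K"
    then obtain x' y' where "x' \<in> ?L" "x = x' \<odot> ?w" "y' \<in> ?L" "y = y' \<odot> ?w" by blast
    \<comment> \<open>Regrouping leaves \<open>?w\<close> as the last factor, and a word headed by
      the variable remains so when anything is appended.\<close>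
    then have "x \<odot> y = (x' \<odot> (?w \<odot> y')) \<odot> ?w" "x' \<odot> (?w \<odot> y') \<in> ?L"
      using L ultra_uprod uw by (auto simp: uprod.assoc)
    then show "x \<odot> y \<in> ?K" by blast
  qed
  obtain x where x: "x \<in> ?L" "u = x \<odot> ?w" using u(1) by blast
  have uM: "push (inst a) u \<in> M" for a
  proof -
    have "push (inst a) u = push (inst a) x \<odot> w"
      unfolding x by (simp add: push_uprod inst_append push_push inst_map_Some) (simp add: push_def)
    then show ?thesis using M(3) x w ultra_push by auto
  qed
  have idem: "push (inst a) u \<odot> push (inst a) u = push (inst a) u" for a
    using u(2) push_uprod[of "inst a" u u] inst_append by metis
  have closed: "p \<odot> q \<in> M" if "p \<in> M" "q \<in> M" for p q using that M by blast
  show ?thesis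
  proof (rule that[of M u])
    show "ultra u" "u (\<lambda>x. \<exists>x'. x = None # x')" using L[OF x(1) uw] x(2) by auto
    show "p \<odot> push (inst a) u = p" if "p \<in> M" for a p
      using uprod.minimal_left_ideal_right_identity[OF M(4) uM idem that] .
    show "\<exists>y\<in>M. \<forall>p\<in>M. (p \<odot> m) \<odot> y = p" if "m \<in> M" for m
      using uprod.minimal_left_ideal_cancel[OF closed M(4) uM idem that] .
  qed (use M uM in auto)
qed

subsection \<open>Words with prescribed 2-adic lengths\<close>

text \<open>Rigid surjections: \<open>f\<close> gives the index of the class of a point,
  \<open>p\<close> lists the class minima. The last clause says that \<open>p k\<close> is the least
  element of the fibre of \<open>k\<close>.\<close>

definition rsurj :: "(nat \<Rightarrow> nat) \<Rightarrow> (nat \<Rightarrow> nat) \<Rightarrow> bool" where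
  "rsurj f p \<longleftrightarrow> strict_mono p \<and> (\<forall>k. f (p k) = k) \<and> (\<forall>x. p (f x) \<le> x)"

abbreviation val :: "nat \<Rightarrow> nat" where
  "val k \<equiv> multiplicity 2 (k + 1)"

lemma multiplicity_two_eqI:
  assumes "(n :: nat) mod 2 ^ Suc h = 2 ^ h"
  shows "multiplicity 2 n = h"
proof (rule multiplicity_eqI)
  have "n = 2 ^ Suc h * (n div 2 ^ Suc h) + 2 ^ h" using assms by (metis mult_div_mod_eq)
  also have "\<dots> = 2 ^ h * (2 * (n div 2 ^ Suc h) + 1)" by (simp add: algebra_simps)
  finally show "2 ^ h dvd n" by (metis dvd_triv_left)
  show "\<not> 2 ^ Suc h dvd n" using assms by (simp add: dvd_eq_mod_eq_0)
qed

text \<open>A number congruent to \<open>2 ^ h\<close> modulo \<open>2 ^ Suc h\<close> has valuation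
  \<open>h\<close>, and every window of \<open>2 ^ Suc h\<close> consecutive numbers contains
  one.\<close>

lemma val_shift: "\<exists>r\<in>{..<2 ^ Suc h}. val (x + r) = h"
proof -
  define N :: nat where "N = 2 ^ Suc h"
  have N: "0 < N" "2 ^ h < N" unfolding N_def by auto
  define r where "r = (2 ^ h + (N - (x + 1) mod N)) mod N"
  have "(x + r) + 1 = (x + 1) + r" by simp
  also have "\<dots> mod N = ((x + 1) + (2 ^ h + (N - (x + 1) mod N))) mod N"
    unfolding r_def by (rule mod_add_right_eq)
  also have "\<dots> = ((x + 1) mod N + (2 ^ h + (N - (x + 1) mod N))) mod N"
    by (rule mod_add_left_eq[symmetric])
  also have "(x + 1) mod N + (2 ^ h + (N - (x + 1) mod N)) = 2 ^ h + N"
    using N mod_less_divisor[of N "x + 1"] by linarith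
  also have "(2 ^ h + N) mod N = 2 ^ h" using N by simp
  finally have "val (x + r) = h" unfolding N_def by (rule multiplicity_two_eqI)
  moreover have "r < N" using N unfolding r_def by simp
  ultimately show ?thesis unfolding N_def by blast
qed

lemma exists_large_val: "\<exists>x\<ge>m. val x = h"
  using val_shift[of h m] le_add1 by blast

text \<open>Padding by a constant word corrects the length. The padding depends on the words drawn
  but takes finitely many values, so the ultrafilters make it constant; prepending it to
  \<open>w\<close> stays in the left ideal \<open>M\<close>.\<close>

lemma ultra_length_val:
  assumes "M \<noteq> {}" "\<And>p. p \<in> M \<Longrightarrow> ultra p" "\<And>p m. ultra p \<Longrightarrow> m \<in> M \<Longrightarrow> p \<odot> m \<in> M"
    and f: "ultra f"
  obtains z where "z \<in> M" "(f \<odot> z) (\<lambda>t :: nat list. val (l + length t) = h)"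
proof -
  obtain w where w: "w \<in> M" "ultra w" using assms by blast
  let ?N = "{..<2 ^ Suc h :: nat}"
  have "f (\<lambda>s. w (\<lambda>t. \<exists>r\<in>?N. val ((l + length s + length t) + r) = h))"
    using val_shift ultra_True[OF w(2)] ultra_True[OF f] by simp
  then have "f (\<lambda>s. \<exists>r\<in>?N. w (\<lambda>t. val ((l + length s + length t) + r) = h))"
    by (rule ultra_mono[OF f]) (rule ultra_finite_bex[OF w(2)], auto)
  then obtain r where r: "f (\<lambda>s. w (\<lambda>t. val ((l + length s + length t) + r) = h))"
    using ultra_finite_bex[OF f, of ?N "\<lambda>r s. w (\<lambda>t. val ((l + length s + length t) + r) = h)"] by auto
  let ?z = "(\<lambda>P. P (replicate r 0)) \<odot> w"
  have "(f \<odot> ?z) (\<lambda>t :: nat list. val (l + length t) = h)"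
    using r by (simp add: uprod_def ac_simps)
  moreover have "?z \<in> M" using assms(3)[OF ultra_principal w(1)] .
  ultimately show ?thesis using that by blast
qed

text \<open>
  The block \<open>x\<close> is drawn from \<open>u\<close> followed by some \<open>z \<in> M\<close>. If the target length must have the valuation
  \<open>j\<close> of the coloured words, then \<open>z = q\<close> completes the words already; otherwise \<open>z\<close> only adjusts the
  length and \<open>q' = y \<odot> q\<close> cancels it.
\<close>

lemma variable_word_step:
  fixes C :: "nat list \<Rightarrow> bool" and T :: "(nat list \<times> nat \<times> nat) set"
  assumes M: "M \<noteq> {}" "\<And>p. p \<in> M \<Longrightarrow> ultra p" "\<And>p m. ultra p \<Longrightarrow> m \<in> M \<Longrightarrow> p \<odot> m \<in> M"
    and u: "ultra u" "u (\<lambda>x. \<exists>x'. x = None # x')" "\<And>a. push (inst a) u \<in> M"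
    and right_id: "\<And>a p. p \<in> M \<Longrightarrow> p \<odot> push (inst a) u = p"
    and cancel: "\<And>m. m \<in> M \<Longrightarrow> \<exists>y\<in>M. \<forall>p\<in>M. (p \<odot> m) \<odot> y = p"
    and C: "\<And>w. C w \<Longrightarrow> val (length w) = j"
    and T: "finite T" "T \<noteq> {}" "\<And>w a b. (w, a, b) \<in> T \<Longrightarrow> length w = l"
    and q: "q \<in> M" "\<And>w a b. (w, a, b) \<in> T \<Longrightarrow> (push (inst a) u \<odot> q) (\<lambda>t. C (w @ t))"
  obtains x q' where "\<exists>x'. x = None # x'" "q' \<in> M" "val (l + length x) = h"
    "\<And>w a b. (w, a, b) \<in> T \<Longrightarrow> (push (inst b) u \<odot> q') (\<lambda>t. C ((w @ inst a x) @ t))"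
    "\<And>w a b. (w, a, b) \<in> T \<Longrightarrow> h = j \<Longrightarrow> C (w @ inst a x)"
proof -
  let ?e = "\<lambda>a. push (inst a) u"
  \<comment> \<open>The equation lets a block drawn along \<open>?e a \<odot> z\<close>, followed by
    a block in a new letter \<open>b\<close>, replace the completion \<open>?e a \<odot> q\<close>.
    The factor \<open>?e b\<close> is absorbed on the right of an element of
    \<open>M\<close>.\<close>
  have "\<exists>z q'. z \<in> M \<and> q' \<in> M \<and> (\<forall>a b. ?e a \<odot> z \<odot> (?e b \<odot> q') = ?e a \<odot> q) \<and>
     (\<exists>a. (?e a \<odot> z) (\<lambda>t. val (l + length t) = h)) \<and> (h = j \<longrightarrow> z = q)"
  proof (cases "h = j")
    case True
    \<comment> \<open>Here \<open>q'\<close> is \<open>?e 0\<close>: once \<open>z = q\<close> has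
      been used, right identities of \<open>M\<close> can follow without effect.\<close>
    have "?e a \<odot> q \<odot> (?e b \<odot> ?e 0) = ?e a \<odot> q" for a b
      using right_id u(3) q(1) M(2,3) by (simp flip: uprod.assoc)
    moreover obtain w a b where wab: "(w, a, b) \<in> T" using T(2) by auto
    have "(?e a \<odot> q) (\<lambda>t. val (l + length t) = h)"
    proof (rule ultra_mono[where p = "?e a \<odot> q" and P = "\<lambda>t. C (w @ t)"])
      show "ultra (?e a \<odot> q)" using M(2) u(3) q(1) ultra_uprod by blast
      show "(?e a \<odot> q) (\<lambda>t. C (w @ t))" using q(2)[OF wab] .
      show "val (l + length t) = h" if "C (w @ t)" for t using C[OF that] T(3)[OF wab] True by simp
    qed
    ultimately show ?thesis using q(1) u(3) True by blast
  next
    case False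
    obtain z where z: "z \<in> M" "(?e 0 \<odot> z) (\<lambda>t. val (l + length t) = h)"
      using ultra_length_val[OF M, of "?e 0" l h] M(2) u(3) by blast
    obtain y where y: "y \<in> M" "\<And>p. p \<in> M \<Longrightarrow> p \<odot> z \<odot> y = p" using cancel[OF z(1)] by blast
    have "?e a \<odot> z \<odot> (?e b \<odot> (y \<odot> q)) = ?e a \<odot> q" for a b
    proof -
      have "?e a \<odot> z \<in> M" using z M u by blast
      then have "?e a \<odot> z \<odot> ?e b = ?e a \<odot> z" by (rule right_id)
      then show ?thesis using y(2)[OF u(3)] by (simp flip: uprod.assoc)
    qed
    moreover have "y \<odot> q \<in> M" using y q M by blast
    ultimately show ?thesis using z False by blast
  qed
  then obtain z q' a0 where z: "z \<in> M" and q': "q' \<in> M"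
    and eq: "\<And>a b. ?e a \<odot> z \<odot> (?e b \<odot> q') = ?e a \<odot> q"
    and len: "(?e a0 \<odot> z) (\<lambda>t. val (l + length t) = h)" and zq: "h = j \<Longrightarrow> z = q"
    by blast
  \<comment> \<open>Blocks are drawn as a variable word from \<open>u\<close> followed by a
    variable-free word from \<open>z\<close>. Substituting \<open>a\<close> turns this into
    \<open>?e a \<odot> z\<close>.\<close>
  let ?U = "u \<odot> push (map Some) z"
  have U: "ultra ?U" using u M z by (simp add: ultra_uprod ultra_push)
  have push: "push (inst a) ?U = ?e a \<odot> z" for a
    by (simp add: push_uprod inst_append push_push inst_map_Some) (simp add: push_def)
  have 1: "?U (\<lambda>x. \<exists>x'. x = None # x')"
    unfolding uprod_def
  proof (rule ultra_mono[OF u(1,2)])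
    fix s :: "nat option list" assume "\<exists>x'. s = None # x'"
    moreover have "push (map Some) z (\<lambda>x. True)"
      using ultra_True[OF ultra_push[OF M(2)[OF z]]] .
    ultimately show "push (map Some) z (\<lambda>t. \<exists>x'. s @ t = None # x')" by auto
  qed
  have 2: "?U (\<lambda>x. val (l + length x) = h)"
    using len unfolding push[symmetric] by (simp add: push_def length_inst)
  have 3: "?U (\<lambda>x. \<forall>(w, a, b)\<in>T. (?e b \<odot> q') (\<lambda>t. C ((w @ inst a x) @ t)))"
  proof (rule ultra_finite_ball[OF U T(1)])
    fix i assume "i \<in> T"
    obtain w a b where i: "i = (w, a, b)" by (cases i)
    have "(?e a \<odot> z \<odot> (?e b \<odot> q')) (\<lambda>t. C (w @ t))" using eq q(2) \<open>i \<in> T\<close> i by simp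
    then have "(?e a \<odot> z) (\<lambda>s. (?e b \<odot> q') (\<lambda>t. C (w @ s @ t)))"
      by (subst (asm) uprod_def)
    then show "?U (\<lambda>x. case i of (w, a, b) \<Rightarrow> (?e b \<odot> q') (\<lambda>t. C ((w @ inst a x) @ t)))"
      unfolding i push[symmetric] by (simp add: push_def)
  qed
  have 4: "?U (\<lambda>x. \<forall>(w, a, b)\<in>T. h = j \<longrightarrow> C (w @ inst a x))"
  proof (rule ultra_finite_ball[OF U T(1)])
    fix i assume "i \<in> T"
    obtain w a b where i: "i = (w, a, b)" by (cases i)
    show "?U (\<lambda>x. case i of (w, a, b) \<Rightarrow> h = j \<longrightarrow> C (w @ inst a x))"
    proof (cases "h = j")
      case True
      then have "(?e a \<odot> z) (\<lambda>t. C (w @ t))" using zq q(2) \<open>i \<in> T\<close> i by simp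
      then show ?thesis unfolding i push[symmetric] by (simp add: push_def True)
    next
      case False
      then show ?thesis using i ultra_True[OF U] by simp
    qed
  qed
  have "?U (\<lambda>x. ((\<exists>x'. x = None # x') \<and> val (l + length x) = h) \<and>
     (\<forall>(w, a, b)\<in>T. (?e b \<odot> q') (\<lambda>t. C ((w @ inst a x) @ t))) \<and>
     (\<forall>(w, a, b)\<in>T. h = j \<longrightarrow> C (w @ inst a x)))"
    using 1 2 3 4 by (simp only: ultra_conj[OF U])
  then obtain x where x: "((\<exists>x'. x = None # x') \<and> val (l + length x) = h) \<and>
     (\<forall>(w, a, b)\<in>T. (?e b \<odot> q') (\<lambda>t. C ((w @ inst a x) @ t))) \<and>
     (\<forall>(w, a, b)\<in>T. h = j \<longrightarrow> C (w @ inst a x))"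
    by (rule ultra_witness[OF U])
  show ?thesis
    by (rule that[of x q']) (use x q' in \<open>blast+\<close>)
qed

text \<open>\<open>Y\<close> collects the possible ways to extend a fixed approximation. They agree
  up to \<open>d\<close>, and \<open>\<beta> i\<close> is an old class that all of them send to
  \<open>i\<close>. The map \<open>h\<close> is an infinite word assembled from blocks supplied by
  \<open>variable_word_step\<close>, the variable of each block becoming a new class, and
  \<open>q\<close> lists the positions where the blocks begin.\<close>

lemma word_pigeonhole:
  fixes Y :: "(nat \<Rightarrow> nat) set" and Q :: "nat list \<Rightarrow> bool"
  assumes Y: "Y \<noteq> {}" "\<And>y i. y \<in> Y \<Longrightarrow> y i \<le> n"
      "\<And>y y' i. \<lbrakk>y \<in> Y; y' \<in> Y; i \<le> d\<rbrakk> \<Longrightarrow> y i = y' i"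
    and \<beta>: "\<And>i. i \<le> n \<Longrightarrow> \<beta> i \<le> d" "\<And>i y. \<lbrakk>i \<le> n; y \<in> Y\<rbrakk> \<Longrightarrow> y (\<beta> i) = i"
  shows "\<exists>h q c. rsurj h q \<and> (\<forall>k. val (q k) = val k) \<and> (\<forall>i\<le>d. q i = i) \<and>
    (\<forall>y\<in>Y. \<forall>k>d. val k = j \<longrightarrow> (Q (map (y \<circ> h) [0..<q k]) \<longleftrightarrow> c))"
proof -
  obtain M and u :: "(nat option list \<Rightarrow> bool) \<Rightarrow> bool" where
    M: "M \<noteq> {}" "\<And>p. p \<in> M \<Longrightarrow> ultra p" "\<And>p m. ultra p \<Longrightarrow> m \<in> M \<Longrightarrow> p \<odot> m \<in> M"
    and u: "ultra u" "u (\<lambda>x. \<exists>x'. x = None # x')" "\<And>a. push (inst a) u \<in> M"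
    and right_id: "\<And>a p. p \<in> M \<Longrightarrow> p \<odot> push (inst a) u = p"
    and cancel: "\<And>m. m \<in> M \<Longrightarrow> \<exists>y\<in>M. \<forall>p\<in>M. (p \<odot> m) \<odot> y = p"
    by (rule left_variable_ultrafilter) blast
  let ?e = "\<lambda>a. push (inst a) u"
  obtain y0 where y0: "y0 \<in> Y" using Y(1) by blast
  let ?w0 = "map y0 [0..<d]"
  obtain q0 where q0: "q0 \<in> M" "(?e (y0 d) \<odot> q0) (\<lambda>t. val (d + length t) = j)"
    using ultra_length_val[OF M, of "?e (y0 d)" d j] M(2) u(3) by blast
  let ?p0 = "?e (y0 d) \<odot> q0"
  have p0: "ultra ?p0" using M(2) q0(1) u(3) ultra_uprod by blast
  \<comment> \<open>\<open>c\<close> is the colour of \<open>?p0\<close>-almost all continuations of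
    the initial word, so \<open>C\<close> holds almost everywhere.\<close>
  define c where "c = ?p0 (\<lambda>t. Q (map (min n) (?w0 @ t)))"
  define C where "C w \<longleftrightarrow> val (length w) = j \<and> (Q (map (min n) w) \<longleftrightarrow> c)" for w
  have "?p0 (\<lambda>t. Q (map (min n) (?w0 @ t)) \<longleftrightarrow> c)"
  proof (cases c)
    case True
    then show ?thesis using c_def by simp
  next
    case False
    then show ?thesis using c_def ultra_not[OF p0, of "\<lambda>t. Q (map (min n) (?w0 @ t))"] by simp
  qed
  then have C0: "?p0 (\<lambda>t. C (?w0 @ t))"
    using q0(2) ultra_conj[OF p0] unfolding C_def by simp
  have C_val: "val (length w) = j" if "C w" for w using that unfolding C_def by blast
  \<comment> \<open>A constant letter \<open>c\<close> is realised by the old class \<open>\<beta> (min n c)\<close>; truncating by \<open>n\<close> keeps the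
    ultrafilters on the full set of words.\<close>
  define sub where "sub k = map (case_option k (\<lambda>c. \<beta> (min n c)))" for k :: nat
  have C_sub: "C (map y (H @ sub k x) @ t) \<longleftrightarrow> C ((map y H @ inst (y k) x) @ t)" if "y \<in> Y" for y H k x t
  proof -
    have "min n (y (\<beta> (min n c))) = min n c" for c using \<beta>(2)[of "min n c" y] that by simp
    then have "map (min n) (map y (sub k x)) = map (min n) (inst (y k) x)"
      by (auto simp: sub_def inst_def split: option.split)
    then show ?thesis unfolding C_def by (simp add: sub_def length_inst)
  qed
  \<comment> \<open>The length built so far is graded like \<open>d + i\<close>. For every
    \<open>y\<close>, almost all continuations satisfy \<open>C\<close> when the next block carries
    the letter \<open>y (d + i)\<close>.\<close>
  define inv where "inv i S \<longleftrightarrow> snd S \<in> M \<and> val (length (fst S)) = val (d + i) \<and> d + i \<le> length (fst S) \<and>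
    (\<forall>y\<in>Y. (?e (y (d + i)) \<odot> snd S) (\<lambda>t. C (map y (fst S) @ t))) \<and>
    (i = 0 \<longrightarrow> fst S = [0..<d])" for i :: nat and S :: "nat list \<times> ((nat list \<Rightarrow> bool) \<Rightarrow> bool)"
  define step where "step i S S' \<longleftrightarrow> (\<exists>x. fst S' = fst S @ sub (d + i) (None # x)) \<and>
    (val (d + Suc i) = j \<longrightarrow> (\<forall>y\<in>Y. C (map y (fst S'))))"
    for i :: nat and S S' :: "nat list \<times> ((nat list \<Rightarrow> bool) \<Rightarrow> bool)"
  have "\<exists>S. \<forall>i. inv i (S i) \<and> step i (S i) (S (Suc i))"
  proof (rule dependent_nat_choice)
    have "(?e (y d) \<odot> q0) (\<lambda>t. C (map y [0..<d] @ t))" if "y \<in> Y" for y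
    proof -
      have eq: "y d = y0 d" "map y [0..<d] = ?w0" using Y(3)[OF that y0] by auto
      show ?thesis unfolding eq by (fact C0)
    qed
    then have "inv 0 ([0..<d], q0)" unfolding inv_def using q0(1) by simp
    then show "\<exists>S. inv 0 S" by blast
  next
    fix S i assume S: "inv i S"
    obtain H q where Hq: "S = (H, q)" by (cases S)
    \<comment> \<open>\<open>Y\<close> may be infinite, but it enters only through words of fixed
      length over \<open>{..n}\<close> and two more values, so one block serves all of
      \<open>Y\<close>.\<close>
    let ?T = "(\<lambda>y. (map y H, y (d + i), y (d + Suc i))) ` Y"
    have "?T \<subseteq> {w. set w \<subseteq> {..n} \<and> length w = length H} \<times> {..n} \<times> {..n}"
      using Y(2) by auto
    then have "finite ?T" by (rule finite_subset) (intro finite_cartesian_product finite_lists_length_eq finite_atMost)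
    obtain x q' where x: "\<exists>x'. x = None # x'" and q': "q' \<in> M" and len: "val (length H + length x) = val (d + Suc i)"
      and 1: "\<And>w a b. (w, a, b) \<in> ?T \<Longrightarrow> (?e b \<odot> q') (\<lambda>t. C ((w @ inst a x) @ t))"
      and 2: "\<And>w a b. (w, a, b) \<in> ?T \<Longrightarrow> val (d + Suc i) = j \<Longrightarrow> C (w @ inst a x)"
    proof (rule variable_word_step[where C = C and T = ?T and l = "length H" and q = q and h = "val (d + Suc i)",
          OF M u right_id cancel C_val \<open>finite ?T\<close>])
      show "q \<in> M" using S Hq unfolding inv_def by simp
      show "(?e a \<odot> q) (\<lambda>t. C (w @ t))" if "(w, a, b) \<in> ?T" for w a b
        using that S Hq unfolding inv_def by auto
    qed (use Y(1) in auto)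
    let ?H = "H @ sub (d + i) x"
    have "(?e (y (d + Suc i)) \<odot> q') (\<lambda>t. C (map y ?H @ t))" if "y \<in> Y" for y
      using 1 that unfolding C_sub[OF that] by blast
    moreover have "length ?H = length H + length x" by (simp add: sub_def)
    moreover have "d + Suc i \<le> length H + length x"
      using S x unfolding inv_def Hq by auto
    ultimately have "inv (Suc i) (?H, q')"
      using S len q' unfolding inv_def Hq by simp
    moreover have "C (map y ?H)" if "y \<in> Y" "val (d + Suc i) = j" for y
      using 2 that(2) C_sub[OF that(1), of H "d + i" x "[]"] that(1) by auto
    then have "step i S (?H, q')" unfolding step_def Hq using x by auto
    ultimately show "\<exists>S'. inv (Suc i) S' \<and> step i S S'" by blast
  qed
  then obtain S where inv: "\<And>i. inv i (S i)" and step: "\<And>i. step i (S i) (S (Suc i))" by blast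
  define H where "H i = fst (S i)" for i
  define l where "l i = length (H i)" for i
  have H0: "H 0 = [0..<d]" and l_val: "val (l i) = val (d + i)" and l_ge: "d + i \<le> l i" for i
    using inv[of 0] inv[of i] unfolding inv_def H_def l_def by auto
  obtain xs where H_Suc: "\<And>i. H (Suc i) = H i @ sub (d + i) (None # xs i)"
    using step unfolding step_def H_def by metis
  have H_C: "C (map y (H (Suc i)))" if "y \<in> Y" "val (d + Suc i) = j" for y i
    using step[of i] that unfolding step_def H_def by blast
  have l0: "l 0 = d" by (simp add: l_def H0)
  have l_less: "l i < l (Suc i)" for i unfolding l_def H_Suc by (simp add: sub_def)
  have l_mono: "l i \<le> l k" if "i \<le> k" for i k
    using lift_Suc_mono_le[of l, OF less_imp_le[OF l_less] that] .
  have nth_H: "H k ! x = H i ! x" if "i \<le> k" "x < l i" for i k x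
    using that(1)
  proof (induction k rule: dec_induct)
    case (step k)
    then have "x < length (H k)" using that(2) l_mono[of i k] unfolding l_def by simp
    then show ?case using step by (simp add: H_Suc nth_append)
  qed simp
  \<comment> \<open>Position \<open>x\<close> is read from \<open>H (Suc x)\<close>, which is longer
    than \<open>x\<close>; later words only extend it.\<close>
  define h where "h x = H (Suc x) ! x" for x
  have h_eq: "h x = H i ! x" if "x < l i" for x i
  proof (cases "i \<le> Suc x")
    case True
    then show ?thesis using nth_H[OF True that] unfolding h_def by simp
  next
    case False
    then show ?thesis using nth_H[of "Suc x" i x] l_ge[of "Suc x"] unfolding h_def by simp
  qed
  then have map_h: "map h [0..<l i] = H i" for i
    by (intro nth_equalityI) (auto simp: l_def)
  \<comment> \<open>Below \<open>d\<close> every class is its own minimum. From \<open>d\<close> on,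
    block \<open>i\<close> starts with its variable, so the new class \<open>d + i\<close> first
    occurs at \<open>l i\<close>.\<close>
  define q where "q k = (if k < d then k else l (k - d))" for k
  have q_le: "q i = i" if "i \<le> d" for i using that l0 unfolding q_def by auto
  have q_ge: "q (d + i) = l i" for i unfolding q_def by simp
  have q_mono: "strict_mono q"
  proof (rule strict_mono_Suc_iff[THEN iffD2, rule_format])
    fix k show "q k < q (Suc k)"
    proof (cases "k < d")
      case True
      then show ?thesis using q_le[of k] q_le[of "Suc k"] by simp
    next
      case False
      then obtain i where "k = d + i" using le_Suc_ex not_less by blast
      then show ?thesis using q_ge[of i] q_ge[of "Suc i"] l_less[of i] by simp
    qed
  qed
  have "h (q k) = k" for k
  proof (cases "k < d")
    case True
    then show ?thesis using h_eq[of k 0] q_le[of k] l0 H0 by simp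
  next
    case False
    then obtain i where i: "k = d + i" using le_Suc_ex not_less by blast
    have "h (l i) = H (Suc i) ! l i" using h_eq l_less by blast
    also have "\<dots> = k" unfolding H_Suc l_def i by (simp add: nth_append sub_def)
    finally show ?thesis using q_ge i by simp
  qed
  moreover have "q (h x) \<le> x" if "x < l i" for x i
    using that
  proof (induction i)
    case 0
    then show ?case using h_eq[of x 0] l0 H0 q_le[of x] by simp
  next
    case (Suc i)
    show ?case
    proof (cases "x < l i")
      case False
      then have "h x = sub (d + i) (None # xs i) ! (x - l i)"
        using h_eq[OF Suc.prems] unfolding H_Suc l_def by (simp add: nth_append)
      moreover have "x - l i < length (sub (d + i) (None # xs i))"
        using Suc.prems False unfolding l_def H_Suc by simp
      ultimately have "h x \<in> set (sub (d + i) (None # xs i))" by (metis nth_mem)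
      \<comment> \<open>A variable in the block stands for \<open>d + i\<close> and a constant for
        an old class, at most \<open>d\<close>. Hence no class occurs before its block.\<close>
      then have "h x \<le> d + i"
        using \<beta>(1) by (force simp: sub_def split: option.splits intro: le_trans[OF \<beta>(1)])
      then have "q (h x) \<le> q (d + i)" using q_mono by (simp add: strict_mono_less_eq)
      then show ?thesis using q_ge False by simp
    qed (use Suc.IH in blast)
  qed
  then have "q (h x) \<le> x" for x using l_ge[of "Suc x"] by (meson Suc_le_lessD add_leE)
  ultimately have r: "rsurj h q" unfolding rsurj_def using q_mono by blast
  have v: "val (q k) = val k" for k
  proof (cases "k < d")
    case False
    then obtain i where "k = d + i" using le_Suc_ex not_less by blast
    then show ?thesis using q_ge l_val by simp
  qed (simp add: q_le)
  have "Q (map (y \<circ> h) [0..<q k]) \<longleftrightarrow> c" if y: "y \<in> Y" and k: "d < k" "val k = j" for y k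
  proof -
    obtain i where i: "k = d + Suc i" using k(1) less_iff_Suc_add by auto
    have "map (min n) (map y (H (Suc i))) = map y (H (Suc i))" using Y(2)[OF y] by (auto simp: min_absorb2)
    moreover have "map (y \<circ> h) [0..<q k] = map y (H (Suc i))"
      using map_h[of "Suc i"] q_ge[of "Suc i"] i by (metis map_map)
    moreover have "Q (map (min n) (map y (H (Suc i)))) \<longleftrightarrow> c"
      using H_C[OF y, of i] k(2)[unfolded i] unfolding C_def by blast
    ultimately show ?thesis by (simp only:)
  qed
  then show ?thesis
    by (intro exI[of _ h] exI[of _ q] exI[of _ c] conjI ballI allI impI r v q_le)
qed

subsection \<open>Coding equivalence relations by maps\<close>

lemma rsurj_less: "rsurj f p \<Longrightarrow> x < p k \<Longrightarrow> f x < k"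
  unfolding rsurj_def by (meson le_less_trans strict_mono_less)

lemma rsurj_image:
  assumes "rsurj f p"
  shows "f ` {..<p k} = {..<k}"
proof
  show "f ` {..<p k} \<subseteq> {..<k}" using rsurj_less[OF assms] by auto
  show "{..<k} \<subseteq> f ` {..<p k}"
  proof
    fix i assume "i \<in> {..<k}"
    then have "p i \<in> {..<p k}" "f (p i) = i" using assms unfolding rsurj_def by (auto simp: strict_mono_less)
    then show "i \<in> f ` {..<p k}" by force
  qed
qed

lemma rsurj_comp:
  assumes "rsurj f p" "rsurj g q"
  shows "rsurj (g \<circ> f) (p \<circ> q)"
  using assms unfolding rsurj_def
  by (auto simp: strict_mono_o intro: le_trans[OF strict_mono_leD])

text \<open>Induction on \<open>x\<close>. A point that is not minimal for one of the maps shares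
  its class with a smaller point. A point minimal for both starts a new class, whose index is the
  number of classes already seen.\<close>

lemma rsurj_unique_below:
  assumes f: "rsurj f p" and f': "rsurj f' p'"
    and ker: "\<And>x y. x < N \<Longrightarrow> y < N \<Longrightarrow> f x = f y \<longleftrightarrow> f' x = f' y"
  shows "x < N \<Longrightarrow> f x = f' x"
proof (induction x rule: less_induct)
  case (less x)
  have p: "p (f x) \<le> x" "f (p (f x)) = f x" "p' (f' x) \<le> x" "f' (p' (f' x)) = f' x"
    using f f' unfolding rsurj_def by auto
  consider "p (f x) < x" | "p' (f' x) < x" | "p (f x) = x" "p' (f' x) = x" using p by linarith
  then show ?case
  proof cases
    case 1
    then show ?thesis using less ker[of "p (f x)" x] p by (metis less_trans)
  next
    case 2
    then show ?thesis using less ker[of "p' (f' x)" x] p by (metis less_trans)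
  next
    case 3
    have "{..<f x} = f ` {..<x}" using rsurj_image[OF f, of "f x"] 3 by simp
    also have "\<dots> = f' ` {..<x}" using less by (intro image_cong) auto
    also have "\<dots> = {..<f' x}" using rsurj_image[OF f', of "f' x"] 3 by simp
    finally show ?thesis by (simp add: lessThan_eq_iff)
  qed
qed

lemma rsurj_min_unique:
  assumes "rsurj f p" "rsurj f' p'" "f (p k) = f' (p k)" "f (p' k) = f' (p' k)"
  shows "p k = p' k"
  using assms unfolding rsurj_def by (metis le_antisym)

definition kernel :: "(nat \<Rightarrow> nat) \<Rightarrow> nat rel" where
  "kernel f = {(x, y). f x = f y}"

lemma in_kernel [simp]: "(x, y) \<in> kernel f \<longleftrightarrow> f x = f y"
  by (simp add: kernel_def)

lemma equiv_kernel: "equiv UNIV (kernel f)"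
  by (auto simp: equiv_def refl_on_def sym_def trans_def)

lemma coarser_iff:
  assumes E: "equiv UNIV E" and F: "equiv UNIV F"
  shows "coarser E F \<longleftrightarrow> F \<subseteq> E"
proof
  assume c: "coarser E F"
  show "F \<subseteq> E"
  proof (rule subrelI)
    fix x y assume xy: "(x, y) \<in> F"
    obtain S where S: "S \<subseteq> UNIV // F" "E `` {x} = \<Union>S"
      using c unfolding coarser_def by (meson UNIV_I quotientI)
    have "x \<in> E `` {x}" using equiv_class_self[OF E] by simp
    then obtain D where D: "D \<in> S" "x \<in> D" using S by blast
    then have "D = F `` {x}" using S(1) F by (metis UNIV_I equiv_class_eq_iff Image_singleton_iff quotientE subsetD)
    then have "y \<in> \<Union>S" using xy D by blast
    then show "(x, y) \<in> E" using S by blast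
  qed
next
  assume sub: "F \<subseteq> E"
  show "coarser E F"
    unfolding coarser_def
  proof
    fix C assume "C \<in> UNIV // E"
    then obtain x where C: "C = E `` {x}" by (rule quotientE)
    have "C = \<Union>((\<lambda>z. F `` {z}) ` C)"
    proof
      show "C \<subseteq> \<Union>((\<lambda>z. F `` {z}) ` C)" using equiv_class_self[OF F] by blast
      show "\<Union>((\<lambda>z. F `` {z}) ` C) \<subseteq> C"
        using sub E unfolding C by (auto simp: equiv_def dest: transD)
    qed
    moreover have "(\<lambda>z. F `` {z}) ` C \<subseteq> UNIV // F" by (auto intro: quotientI)
    ultimately show "\<exists>\<S>\<subseteq>UNIV // F. C = \<Union>\<S>" by blast
  qed
qed

definition class_index :: "nat rel \<Rightarrow> nat \<Rightarrow> nat" where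
  "class_index E x = inv (class_min E) (LEAST y. (x, y) \<in> E)"

lemma
  assumes E: "equiv UNIV E" and inf: "infinite (UNIV // E)"
  shows rsurj_class_index: "rsurj (class_index E) (class_min E)"
    and kernel_class_index: "kernel (class_index E) = E"
proof -
  define m where "m x = (LEAST y. (x, y) \<in> E)" for x
  have refl: "(x, x) \<in> E" for x using E by (simp add: equiv_def refl_on_def)
  have m: "(x, m x) \<in> E" "m x \<le> x" for x
    unfolding m_def using refl by (rule LeastI, rule Least_le)
  have m_eq: "m x = m y \<longleftrightarrow> (x, y) \<in> E" for x y
  proof
    assume "m x = m y"
    then show "(x, y) \<in> E" using m(1)[of x] m(1)[of y] E by (metis equivE symE transE)
  next
    assume "(x, y) \<in> E"
    then have "(x, z) \<in> E \<longleftrightarrow> (y, z) \<in> E" for z using E by (metis equivE symE transE)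
    then show "m x = m y" unfolding m_def by simp
  qed
  have mm: "m (m x) = m x" for x by (metis m_eq m(1))
  have quot: "UNIV // E = range (\<lambda>x. E `` {x})" unfolding quotient_def by auto
  then have minima: "class_minima E = range m"
    by (simp add: class_minima_def image_image m_def[abs_def])
  have "E `` {x} = E `` {m x}" for x using equiv_class_eq[OF E m(1)] .
  then have "UNIV // E = (\<lambda>z. E `` {z}) ` range m" unfolding quot image_image by simp
  then have "infinite (range m)" using inf by (metis finite_imageI)
  then have sm: "strict_mono (class_min E)" and range: "range (class_min E) = range m"
    unfolding class_min_def[abs_def] minima by (simp_all add: strict_mono_enumerate range_enumerate)
  have ci: "class_min E (class_index E x) = m x" for x
    unfolding class_index_def m_def[symmetric] by (rule f_inv_into_f) (simp add: range)
  have "class_index E (class_min E k) = k" for k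
  proof -
    obtain x where "class_min E k = m x" using range by (metis UNIV_I image_iff)
    then have "class_min E (class_index E (class_min E k)) = class_min E k" using ci mm by simp
    then show ?thesis using sm by (simp add: strict_mono_eq)
  qed
  then show "rsurj (class_index E) (class_min E)"
    unfolding rsurj_def using sm ci m(2) by simp
  have "class_index E x = class_index E y \<longleftrightarrow> (x, y) \<in> E" for x y
    using ci[of x] ci[of y] m_eq[of x y] strict_mono_eq[OF sm] by metis
  then show "kernel (class_index E) = E" by (auto simp: kernel_def)
qed

lemma
  assumes f: "rsurj f p"
  shows infinite_quotient_kernel: "infinite (UNIV // kernel f)"
    and class_index_kernel: "class_index (kernel f) = f"
    and class_min_kernel: "class_min (kernel f) = p"
proof -
  have "inj (\<lambda>k. kernel f `` {p k})"
  proof (rule injI)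
    fix i k assume "kernel f `` {p i} = kernel f `` {p k}"
    then have "f (p i) = f (p k)" by (auto simp: set_eq_iff)
    then show "i = k" using f unfolding rsurj_def by simp
  qed
  moreover have "range (\<lambda>k. kernel f `` {p k}) \<subseteq> UNIV // kernel f" by (auto intro: quotientI)
  ultimately show inf: "infinite (UNIV // kernel f)"
    using finite_subset finite_imageD by blast
  note r = rsurj_class_index[OF equiv_kernel inf] and k = kernel_class_index[OF equiv_kernel inf]
  have eq: "class_index (kernel f) x = class_index (kernel f) y \<longleftrightarrow> f x = f y" for x y
    using in_kernel[of x y "class_index (kernel f)"] unfolding k by simp
  show idx: "class_index (kernel f) = f"
  proof
    fix x show "class_index (kernel f) x = f x"
      by (rule rsurj_unique_below[OF r f, of "Suc x"]) (simp_all add: eq)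
  qed
  show "class_min (kernel f) = p" using rsurj_min_unique[OF r f] idx by (intro ext) simp
qed

section \<open>Graded spaces and their approximations\<close>

text \<open>In the application \<open>c x\<close> is the index of the partition piece that contains
  \<open>x\<close>.\<close>

definition graded_space :: "(nat \<Rightarrow> nat) \<Rightarrow> nat rel set" where
  "graded_space c = {E. equiv UNIV E \<and> infinite (UNIV // E) \<and> (\<forall>k. c (class_min E k) = val k)}"

text \<open>The condition on a map of class indices that keeps its composition with the coding of a
  member inside the graded space, whatever the grading is.\<close>

definition graded :: "(nat \<Rightarrow> nat) \<Rightarrow> (nat \<Rightarrow> nat) \<Rightarrow> bool" where
  "graded g q \<longleftrightarrow> rsurj g q \<and> (\<forall>k. val (q k) = val k)"

lemma
  assumes "graded g q"
  shows graded_rsurj: "rsurj g q" and graded_val: "val (q k) = val k"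
    and graded_mono: "strict_mono q" and graded_eq: "g (q k) = k" and graded_le: "q (g x) \<le> x"
    and graded_less: "x < q k \<Longrightarrow> g x < k"
  using assms rsurj_less unfolding graded_def by (auto simp: rsurj_def)

lemma graded_spaceI:
  assumes "rsurj f p" "\<And>k. c (p k) = val k"
  shows "kernel f \<in> graded_space c"
  using assms unfolding graded_space_def by (simp add: equiv_kernel infinite_quotient_kernel class_min_kernel)

context
  fixes c :: "nat \<Rightarrow> nat"
begin

abbreviation "\<R> \<equiv> graded_space c"
abbreviation "idx \<equiv> class_index"
abbreviation "cm \<equiv> class_min"

lemma
  assumes "E \<in> \<R>"
  shows E_equiv: "equiv UNIV E"
    and E_rsurj: "rsurj (idx E) (cm E)"
    and E_kernel: "kernel (idx E) = E"
    and E_grade: "c (cm E k) = val k"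
    and E_mono: "strict_mono (cm E)"
    and E_eq: "idx E (cm E k) = k"
    and E_le: "cm E (idx E x) \<le> x"
    and E_less: "x < cm E k \<Longrightarrow> idx E x < k"
  using assms rsurj_class_index[of E] kernel_class_index[of E] rsurj_less[of "idx E" "cm E" x k]
  unfolding graded_space_def by (auto simp: rsurj_def)

lemma E_coarser_iff: "\<lbrakk>A \<in> \<R>; B \<in> \<R>\<rbrakk> \<Longrightarrow> coarser A B \<longleftrightarrow> B \<subseteq> A"
  by (simp add: coarser_iff E_equiv)

lemma E_mem: "E \<in> \<R> \<Longrightarrow> (x, y) \<in> E \<longleftrightarrow> idx E x = idx E y"
  using in_kernel[of x y "idx E"] by (simp only: E_kernel)

lemma approx_eq_iff:
  assumes A: "A \<in> \<R>" and B: "B \<in> \<R>"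
  shows "approx m A = approx n B \<longleftrightarrow> m = n \<and> cm A n = cm B n \<and> (\<forall>x < cm B n. idx A x = idx B x)"
proof
  have mem: "(x, y) \<in> approx k E \<longleftrightarrow> x < cm E k \<and> y < cm E k \<and> idx E x = idx E y" if "E \<in> \<R>" for x y k E
    using E_mem[OF that] unfolding approx_def by auto
  {
    assume eq: "approx m A = approx n B"
    have "x < cm A m \<longleftrightarrow> x < cm B n" for x
      using mem[OF A, of x x m] mem[OF B, of x x n] eq by simp
    then have cm: "cm A m = cm B n" by (metis linorder_less_linear order_less_irrefl)
    have "idx A x = idx B x" if "x < cm B n" for x
    proof (rule rsurj_unique_below[OF E_rsurj[OF A] E_rsurj[OF B] _ that])
      show "(idx A x = idx A y) = (idx B x = idx B y)" if "x < cm B n" "y < cm B n" for x y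
        using mem[OF A, of x y m] mem[OF B, of x y n] that cm eq by simp
    qed
    moreover from this have "idx A ` {..<cm A m} = idx B ` {..<cm B n}" using cm by (intro image_cong) auto
    then have "m = n"
      using rsurj_image[OF E_rsurj[OF A], of m] rsurj_image[OF E_rsurj[OF B], of n] by (simp add: lessThan_eq_iff)
    ultimately show "m = n \<and> cm A n = cm B n \<and> (\<forall>x < cm B n. idx A x = idx B x)" using cm by blast
  next
    assume "m = n \<and> cm A n = cm B n \<and> (\<forall>x < cm B n. idx A x = idx B x)"
    then show "approx m A = approx n B" using mem[OF A] mem[OF B] by auto
  }
qed

lemma approx_eqD:
  assumes A: "A \<in> \<R>" and B: "B \<in> \<R>" and eq: "approx m A = approx n B"
  shows "m = n \<and> (\<forall>k\<le>n. approx k A = approx k B)"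
proof (intro conjI allI impI)
  note * = eq[unfolded approx_eq_iff[OF A B]]
  then show "m = n" by blast
  fix k assume k: "k \<le> n"
  have cm: "cm A k = cm B k"
  proof (cases "k = n")
    case False
    then have "cm A k < cm B n" "cm B k < cm B n"
      using k * E_mono[OF A] E_mono[OF B] by (metis le_neq_implies_less strict_mono_less)+
    then show ?thesis using * rsurj_min_unique[OF E_rsurj[OF A] E_rsurj[OF B]] by blast
  qed (use * in blast)
  have "cm B k \<le> cm B n" using k E_mono[OF B] by (simp add: strict_mono_less_eq)
  then show "approx k A = approx k B" unfolding approx_eq_iff[OF A B] using cm * by auto
qed

lemma coarser_factor:
  assumes A: "A \<in> \<R>" and B: "B \<in> \<R>" and le: "coarser A B"
  obtains g q where "graded g q" "idx A = g \<circ> idx B" "cm A = cm B \<circ> q"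
proof
  \<comment> \<open>\<open>?g\<close> sends the index of a class of \<open>B\<close> to that of the
    class of \<open>A\<close> containing it; \<open>?q k\<close> locates the \<open>k\<close>-th
    minimum of \<open>A\<close> among the classes of \<open>B\<close>.\<close>
  let ?g = "idx A \<circ> cm B" and ?q = "idx B \<circ> cm A"
  have AB: "idx A x = idx A y" if "idx B x = idx B y" for x y
    using le that A B by (metis E_coarser_iff E_mem subsetD)
  have idx: "idx A (cm B (idx B x)) = idx A x" for x by (rule AB) (simp add: E_eq[OF B])
  then show 1: "idx A = ?g \<circ> idx B" by (auto simp: fun_eq_iff)
  \<comment> \<open>Each minimum of \<open>A\<close> is a minimum of \<open>B\<close>: the least
    element of its class in \<open>B\<close> lies in the same class of \<open>A\<close>.\<close>
  have cm: "cm B (idx B (cm A k)) = cm A k" for k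
    using idx[of "cm A k"] E_eq[OF A] E_le[OF A] E_le[OF B] by (metis le_antisym)
  then show 2: "cm A = cm B \<circ> ?q" by (auto simp: fun_eq_iff)
  have qm: "strict_mono ?q"
  proof (rule strict_monoI)
    fix i k :: nat assume "i < k"
    then have "cm B (?q i) < cm B (?q k)" using cm E_mono[OF A] by (simp add: strict_mono_less)
    then show "?q i < ?q k" using E_mono[OF B] strict_mono_less by blast
  qed
  have "?g (?q k) = k" for k using idx E_eq[OF A] by simp
  moreover have "?q (?g x) \<le> x" for x
  proof -
    have "cm B (?q (?g x)) \<le> cm B x" using cm E_le[OF A] by simp
    then show ?thesis using E_mono[OF B] strict_mono_less_eq by blast
  qed
  moreover have "val (?q k) = val k" for k
    using cm E_grade[OF A] E_grade[OF B] by (metis comp_apply)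
  ultimately show "graded ?g ?q" unfolding graded_def rsurj_def using qm by blast
qed

text \<open>Merges the classes of \<open>B\<close> along \<open>g\<close>. By
  \<open>coarser_factor\<close> every member below \<open>B\<close> has this form.\<close>

definition pull :: "(nat \<Rightarrow> nat) \<Rightarrow> nat rel \<Rightarrow> nat rel" where
  "pull g B = kernel (g \<circ> idx B)"

lemma
  assumes B: "B \<in> \<R>" and g: "graded g q"
  shows pull_space: "pull g B \<in> \<R>" and pull_coarser: "coarser (pull g B) B"
    and idx_pull: "idx (pull g B) = g \<circ> idx B" and cm_pull: "cm (pull g B) = cm B \<circ> q"
proof -
  have r: "rsurj (g \<circ> idx B) (cm B \<circ> q)" using rsurj_comp[OF E_rsurj[OF B] graded_rsurj[OF g]] .
  show R: "pull g B \<in> \<R>" unfolding pull_def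
    by (rule graded_spaceI[OF r]) (metis comp_apply E_grade[OF B] graded_val[OF g])
  show "idx (pull g B) = g \<circ> idx B" "cm (pull g B) = cm B \<circ> q"
    unfolding pull_def using r by (simp_all add: class_index_kernel class_min_kernel)
  show "coarser (pull g B) B"
    unfolding E_coarser_iff[OF R B] by (auto simp: pull_def E_mem[OF B])
qed

text \<open>An approximation \<open>r\<^sub>n(A)\<close> has field \<open>{..<p\<^sub>n(A)}\<close>, so its depth is the index of \<open>p\<^sub>n(A)\<close> in \<open>B\<close>.\<close>

definition depth :: "nat rel \<Rightarrow> nat rel \<Rightarrow> nat" where
  "depth B a = idx B (card (Field a))"

lemma depth_approx:
  assumes "A \<in> \<R>"
  shows "depth B (approx n A) = idx B (cm A n)"
proof -
  have "Field (approx n A) = {..<cm A n}"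
    using E_mem[OF assms] unfolding approx_def Field_def by auto
  then show ?thesis unfolding depth_def by simp
qed

lemma stemI:
  assumes B: "B \<in> \<R>" and h: "graded h q" and q: "\<And>i. i \<le> d \<Longrightarrow> q i = i"
  shows "pull h B \<in> basic_set \<R> (approx d B) B"
proof -
  have "h i = i" if "i \<le> d" for i using graded_eq[OF h, of i] q[OF that] by simp
  then have "approx d (pull h B) = approx d B"
    unfolding approx_eq_iff[OF pull_space[OF B h] B] idx_pull[OF B h] cm_pull[OF B h]
    using q E_less[OF B] by (auto simp: less_imp_le)
  then show ?thesis unfolding basic_set_def using pull_space[OF B h] pull_coarser[OF B h] by blast
qed

text \<open>Members of \<open>[r\<^sub>n(X), A]\<close> for \<open>A \<in> [r\<^sub>d(B), B]\<close>, where \<open>d\<close> is the depth of \<open>r\<^sub>n(X)\<close> in \<open>B\<close>.\<close>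

lemma basic_set_pull:
  assumes B: "B \<in> \<R>" and X: "X \<in> \<R>" "idx X = g \<circ> idx B" "cm X = cm B \<circ> q" and d: "q n = d"
    and h: "graded h qh" "\<And>i. i \<le> d \<Longrightarrow> qh i = i"
    and Y: "Y \<in> basic_set \<R> (approx n X) (pull h B)"
  obtains y qy where "Y \<in> \<R>" "approx n Y = approx n X" "graded y qy"
    "idx Y = y \<circ> h \<circ> idx B" "cm Y = cm B \<circ> qh \<circ> qy" "qy n = d" "\<And>i. i < d \<Longrightarrow> y i = g i"
proof -
  let ?A = "pull h B"
  have A: "?A \<in> \<R>" using pull_space[OF B h(1)] .
  have YR: "Y \<in> \<R>" and YA: "coarser Y ?A" and eq: "approx n Y = approx n X"
    using Y approx_eqD[OF _ X(1)] unfolding basic_set_def by auto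
  obtain y qy where y: "graded y qy" and iY: "idx Y = y \<circ> idx ?A" and cY: "cm Y = cm ?A \<circ> qy"
    using coarser_factor[OF YR A YA] by blast
  note e = eq[unfolded approx_eq_iff[OF YR X(1)]]
  have "cm B (qh (qy n)) = cm B d" using e cY X(3) d cm_pull[OF B h(1)] by simp
  then have "qh (qy n) = qh d" using E_mono[OF B] h(2)[of d] by (simp add: strict_mono_eq)
  then have qyn: "qy n = d" using graded_mono[OF h(1)] by (simp add: strict_mono_eq)
  have "y i = g i" if "i < d" for i
  proof -
    have "cm B i < cm X n" using that d X(3) E_mono[OF B] by (simp add: strict_mono_less)
    then have "idx Y (cm B i) = idx X (cm B i)" using e by simp
    moreover have "h i = i" using graded_eq[OF h(1), of i] h(2)[of i] that by simp
    ultimately show ?thesis using iY X(2) idx_pull[OF B h(1)] E_eq[OF B] by simp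
  qed
  then show ?thesis
    using that[OF YR eq y] iY cY idx_pull[OF B h(1)] cm_pull[OF B h(1)] qyn by (simp add: o_assoc)
qed

section \<open>Verification of the axioms\<close>

text \<open>The new member keeps the first \<open>d\<close> classes of \<open>B\<close> apart and
  merges each later one according to the class of \<open>X\<close> containing it. Members with
  approximation \<open>r_n(X)\<close> below it therefore cannot split classes of
  \<open>X\<close>.\<close>

lemma graded_refinement:
  assumes B: "B \<in> \<R>" and X: "X \<in> \<R>" and le: "coarser X B"
  shows "\<exists>A \<in> basic_set \<R> (approx (depth B (approx n X)) B) B.
              basic_set \<R> (approx n X) A \<subseteq> basic_set \<R> (approx n X) X"
proof -
  obtain g q where g: "graded g q" and iX: "idx X = g \<circ> idx B" and cX: "cm X = cm B \<circ> q"
    using coarser_factor[OF X B le] by blast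
  define d where "d = q n"
  have depth: "depth B (approx n X) = d"
    unfolding depth_approx[OF X] cX d_def by (simp add: E_eq[OF B])
  \<comment> \<open>The class \<open>\<phi> i\<close> of \<open>X\<close> will supply the class
    \<open>d + i\<close> of the new member, hence the equality of valuations. The start
    \<open>n\<close> is allowed because \<open>d = q n\<close>.\<close>
  have "\<exists>\<phi>. \<forall>i. (val (\<phi> i) = val (d + i) \<and> (i = 0 \<longrightarrow> \<phi> i = n)) \<and> \<phi> i < \<phi> (Suc i)"
  proof (rule dependent_nat_choice)
    show "\<exists>x. val x = val (d + 0) \<and> (0 = (0 :: nat) \<longrightarrow> x = n)"
      using graded_val[OF g, of n] d_def by auto
    show "\<exists>x'. (val x' = val (d + Suc i) \<and> (Suc i = 0 \<longrightarrow> x' = n)) \<and> x < x'" for x i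
      using exists_large_val[of "Suc x" "val (d + Suc i)"] by (auto simp: Suc_le_eq)
  qed
  then obtain \<phi> where \<phi>: "\<And>i. val (\<phi> i) = val (d + i)" "\<phi> 0 = n" "\<And>i. \<phi> i < \<phi> (Suc i)" by blast
  have \<phi>_mono: "strict_mono \<phi>" using \<phi>(3) by (simp add: strict_mono_Suc_iff)
  have \<phi>_ge: "n \<le> \<phi> i" for i using \<phi>_mono \<phi>(2) by (metis le0 strict_mono_less_eq)
  \<comment> \<open>\<open>\<phi>\<close> selects the classes of \<open>X\<close> that stay separate in the new member; all the others are absorbed
    by classes among the first \<open>d + 1\<close>, so that members below it are unions of classes of \<open>X\<close>.\<close>
  define \<eta> where "\<eta> j = (if j \<in> range \<phi> then d + inv \<phi> j else d)" for j
  have \<eta>: "\<eta> (\<phi> i) = d + i" for i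
    unfolding \<eta>_def using strict_mono_imp_inj_on[OF \<phi>_mono] by simp
  define h where "h i = (if i < d then i else if g i < n then q (g i) else \<eta> (g i))" for i
  define q' where "q' k = (if k < d then k else q (\<phi> (k - d)))" for k
  have q'_le: "q' k = k" if "k \<le> d" for k using that \<phi>(2) d_def unfolding q'_def by auto
  have q'_ge: "q' (d + i) = q (\<phi> i)" for i unfolding q'_def by simp
  have qm: "strict_mono q" using graded_mono[OF g] .
  have q_less: "q i < d" if "i < n" for i using that qm unfolding d_def by (simp add: strict_mono_less)
  have "rsurj h q'" unfolding rsurj_def
  proof (intro conjI allI)
    show "strict_mono q'"
    proof (rule strict_mono_Suc_iff[THEN iffD2, rule_format])
      fix k show "q' k < q' (Suc k)"
      proof (cases "k < d")
        case False
        then obtain i where "k = d + i" using le_Suc_ex not_less by blast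
        then show ?thesis using q'_ge[of i] q'_ge[of "Suc i"] \<phi>(3) qm by (simp add: strict_mono_less)
      qed (simp add: q'_le)
    qed
    show "h (q' k) = k" for k
    proof (cases "k < d")
      case False
      then obtain i where i: "k = d + i" using le_Suc_ex not_less by blast
      have "d \<le> q (\<phi> i)" unfolding d_def using \<phi>_ge qm by (simp add: strict_mono_less_eq)
      then show ?thesis using q'_ge[of i] i \<phi>_ge[of i] graded_eq[OF g] \<eta> unfolding h_def by simp
    qed (simp add: q'_le h_def)
    show "q' (h x) \<le> x" for x
    proof (cases "x < d")
      case False
      show ?thesis
      proof (cases "g x < n")
        case True
        then show ?thesis using q_less[OF True] q'_le[of "q (g x)"] False graded_le[OF g, of x] by (simp add: h_def)
      next
        case ge: False
        show ?thesis
        proof (cases "g x \<in> range \<phi>")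
          case True
          then obtain i where "g x = \<phi> i" by blast
          then show ?thesis using ge False \<eta> q'_ge graded_le[OF g, of x] unfolding h_def by simp
        next
          case nr: False
          then have "h x = d" using ge False unfolding h_def \<eta>_def by simp
          then show ?thesis using q'_le[of d] False by simp
        qed
      qed
    qed (simp add: q'_le h_def)
  qed
  moreover have "val (q' k) = val k" for k
  proof (cases "k < d")
    case False
    then obtain i where i: "k = d + i" using le_Suc_ex not_less by blast
    then show ?thesis using q'_ge[of i] \<phi>(1)[of i] graded_val[OF g, of "\<phi> i"] by simp
  qed (simp add: q'_le)
  ultimately have h: "graded h q'" unfolding graded_def by blast
  have "Y \<in> basic_set \<R> (approx n X) X" if mem: "Y \<in> basic_set \<R> (approx n X) (pull h B)" for Y
  proof -
    obtain y qy where Y: "Y \<in> \<R>" "approx n Y = approx n X" and iY: "idx Y = y \<circ> h \<circ> idx B"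
      and yg: "\<And>i. i < d \<Longrightarrow> y i = g i"
      using basic_set_pull[OF B X iX cX d_def[symmetric] h q'_le mem] by metis
    \<comment> \<open>\<open>\<theta>\<close> expresses the coding of \<open>Y\<close> through the
      classes of \<open>X\<close>, which makes \<open>Y\<close> coarser than
      \<open>X\<close>.\<close>
    define \<theta> where "\<theta> j = (if j < n then j else y (\<eta> j))" for j
    have "y (h i) = \<theta> (g i)" for i
    proof (cases "i < d")
      case True
      then have "g i < n" using graded_less[OF g] d_def by blast
      then show ?thesis using True yg unfolding h_def \<theta>_def by simp
    next
      case False
      then show ?thesis
        using yg[OF q_less] graded_eq[OF g] unfolding h_def \<theta>_def by simp
    qed
    then have "idx Y s = \<theta> (idx X s)" for s using iX iY by simp
    then have "X \<subseteq> Y" using E_mem[OF X] E_mem[OF Y(1)] by (metis subrelI)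
    then show ?thesis using Y E_coarser_iff[OF Y(1) X] unfolding basic_set_def by blast
  qed
  then show ?thesis using stemI[OF B h q'_le] unfolding depth by blast
qed

lemma graded_pigeonhole:
  assumes B: "B \<in> \<R>" and X: "X \<in> \<R>" and le: "coarser X B"
  shows "\<exists>A \<in> basic_set \<R> (approx (depth B (approx n X)) B) B.
              (\<forall>Y \<in> basic_set \<R> (approx n X) A. approx (Suc n) Y \<in> Q) \<or>
              (\<forall>Y \<in> basic_set \<R> (approx n X) A. approx (Suc n) Y \<notin> Q)"
proof -
  obtain g q where g: "graded g q" and iX: "idx X = g \<circ> idx B" and cX: "cm X = cm B \<circ> q"
    using coarser_factor[OF X B le] by blast
  define d where "d = q n"
  have depth: "depth B (approx n X) = d"
    unfolding depth_approx[OF X] cX d_def by (simp add: E_eq[OF B])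
  have qm: "strict_mono q" using graded_mono[OF g] .
  \<comment> \<open>The codings of members extending \<open>r_n(X)\<close>, truncated at
    \<open>n\<close>. The value at \<open>d\<close> is \<open>n\<close> because class
    \<open>d\<close> of \<open>B\<close> begins class \<open>n\<close> of such a member.\<close>
  define Ys where "Ys = {y. (\<forall>i. y i \<le> n) \<and> (\<forall>i<d. y i = g i) \<and> y d = n}"
  \<comment> \<open>Recovers an approximation from the word listing, for each class of
    \<open>B\<close> below its length, the class into which it is merged.\<close>
  define word_rel where "word_rel w = {(s, t). s < cm B (length w) \<and> t < cm B (length w) \<and>
     w ! idx B s = w ! idx B t}" for w :: "nat list"
  have gn: "g i < n" if "i < d" for i using graded_less[OF g] that d_def by blast
  have "\<exists>h qh b. rsurj h qh \<and> (\<forall>k. val (qh k) = val k) \<and> (\<forall>i\<le>d. qh i = i) \<and>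
    (\<forall>y\<in>Ys. \<forall>k>d. val k = val (Suc n) \<longrightarrow> (word_rel (map (y \<circ> h) [0..<qh k]) \<in> Q \<longleftrightarrow> b))"
  proof (rule word_pigeonhole)
    have "(\<lambda>i. if i < d then g i else n) \<in> Ys" unfolding Ys_def using gn by (auto simp: less_imp_le)
    then show "Ys \<noteq> {}" by blast
    show "y i = y' i" if "y \<in> Ys" "y' \<in> Ys" "i \<le> d" for y y' i
      using that unfolding Ys_def by (cases "i = d") auto
    show "q i \<le> d" if "i \<le> n" for i using that qm unfolding d_def by (simp add: strict_mono_less_eq)
    show "y (q i) = i" if "i \<le> n" "y \<in> Ys" for i y
    proof (cases "i = n")
      case True
      then show ?thesis using that unfolding Ys_def d_def by simp
    next
      case False
      then have "q i < d" using that qm unfolding d_def by (simp add: strict_mono_less)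
      then show ?thesis using that graded_eq[OF g] unfolding Ys_def by simp
    qed
  qed (auto simp: Ys_def)
  then obtain h qh b where hq: "rsurj h qh" "\<forall>k. val (qh k) = val k" "\<forall>i\<le>d. qh i = i"
    and word_rel: "\<forall>y\<in>Ys. \<forall>k>d. val k = val (Suc n) \<longrightarrow>
       (word_rel (map (y \<circ> h) [0..<qh k]) \<in> Q \<longleftrightarrow> b)"
    by (elim exE conjE) (rule that)
  have h: "graded h qh" using hq(1,2) unfolding graded_def by simp
  have qh: "qh i = i" if "i \<le> d" for i using hq(3) that by simp
  have mono: "word_rel (map (y \<circ> h) [0..<qh k]) \<in> Q \<longleftrightarrow> b"
    if "y \<in> Ys" "d < k" "val k = val (Suc n)" for y k
    using word_rel that by simp
  have "approx (Suc n) Y \<in> Q \<longleftrightarrow> b" if mem: "Y \<in> basic_set \<R> (approx n X) (pull h B)" for Y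
  proof -
    obtain y qy where Y: "Y \<in> \<R>" and y: "graded y qy" and iY: "idx Y = y \<circ> h \<circ> idx B"
      and cY: "cm Y = cm B \<circ> qh \<circ> qy" and qyn: "qy n = d" and yg: "\<And>i. i < d \<Longrightarrow> y i = g i"
      using basic_set_pull[OF B X iX cX d_def[symmetric] h qh mem] by metis
    \<comment> \<open>Truncation puts \<open>y\<close> into \<open>Ys\<close> and does not affect
      the word, since class \<open>Suc n\<close> has not begun before position
      \<open>qh ?k\<close>.\<close>
    let ?k = "qy (Suc n)" and ?y = "\<lambda>i. min n (y i)"
    let ?w = "map (?y \<circ> h) [0..<qh ?k]"
    have "y d = n" using graded_eq[OF y] qyn by metis
    then have "?y \<in> Ys" unfolding Ys_def using yg gn by (auto simp: less_imp_le min_absorb2)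
    moreover have "d < ?k" using graded_mono[OF y] qyn by (metis lessI strict_mono_less)
    moreover have "val ?k = val (Suc n)" using graded_val[OF y] .
    ultimately have "word_rel ?w \<in> Q \<longleftrightarrow> b" using mono by blast
    moreover have "word_rel ?w = approx (Suc n) Y"
    proof -
      have w: "?w ! idx B s = idx Y s" if "s < cm B (qh ?k)" for s
      proof -
        have s: "idx B s < qh ?k" using E_less[OF B that] .
        have "y (h (idx B s)) \<le> n"
          using graded_less[OF y graded_less[OF h s]] by (simp only: less_Suc_eq_le)
        then show ?thesis using s iY by (simp add: min_absorb2)
      qed
      have "approx (Suc n) Y = {(s, t). s < cm B (qh ?k) \<and> t < cm B (qh ?k) \<and> idx Y s = idx Y t}"
        using E_mem[OF Y] cY unfolding approx_def by auto
      also have "\<dots> = word_rel ?w" unfolding word_rel_def using w by auto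
      finally show ?thesis by simp
    qed
    ultimately show ?thesis by simp
  qed
  then show ?thesis using stemI[OF B h qh] unfolding depth by blast
qed

lemma graded_fusion:
  assumes R: "\<And>k. \<B> k \<in> \<R>" and le: "\<And>k. coarser (\<B> (Suc k)) (\<B> k)"
    and eq: "\<And>k. approx (d + k) (\<B> (Suc k)) = approx (d + k) (\<B> k)"
  shows "\<exists>A \<in> \<R>. \<forall>k. coarser A (\<B> k) \<and> approx (d + k) A = approx (d + k) (\<B> k)"
proof -
  have ap: "approx (d + k) (\<B> K) = approx (d + k) (\<B> k)" if "k \<le> K" for k K
    using that
  proof (induction K rule: dec_induct)
    case (step K)
    have "approx (d + k) (\<B> (Suc K)) = approx (d + k) (\<B> K)"
      using approx_eqD[OF R R eq[of K]] step by simp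
    then show ?case using step by simp
  qed simp
  have sub: "\<B> k \<subseteq> \<B> K" if "k \<le> K" for k K
    using that
  proof (induction K rule: dec_induct)
    case (step K)
    then show ?case using le[of K] E_coarser_iff[OF R R] by blast
  qed simp
  have idx_eq: "idx (\<B> K) x = idx (\<B> k) x" if "k \<le> K" "x < cm (\<B> k) (d + k)" for k K x
    using ap[OF that(1)] that(2) unfolding approx_eq_iff[OF R R] by blast
  have cm_eq: "cm (\<B> K) i = cm (\<B> k) i" if "k \<le> K" "i \<le> d + k" for k K i
    using approx_eqD[OF R R ap[OF that(1)]] that(2) unfolding approx_eq_iff[OF R R] by blast
  have ge: "d + k \<le> cm (\<B> k) (d + k)" for k by (rule strict_mono_imp_increasing[OF E_mono[OF R]])
  \<comment> \<open>The limit is read off diagonally. Stage \<open>Suc x\<close> has already fixed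
    an initial part of the line that contains \<open>x\<close>.\<close>
  define f where "f x = idx (\<B> (Suc x)) x" for x
  define p where "p i = cm (\<B> i) i" for i
  have f_eq: "f x = idx (\<B> k) x" if "x < cm (\<B> k) (d + k)" for x k
  proof (cases "k \<le> Suc x")
    case True
    then show ?thesis unfolding f_def using idx_eq that by blast
  next
    case False
    then show ?thesis unfolding f_def using idx_eq[of "Suc x" k x] ge[of "Suc x"] by simp
  qed
  have p_eq: "p i = cm (\<B> k) i" if "i \<le> d + k" for i k
    unfolding p_def using cm_eq[of i k i] cm_eq[of k i i] that by (cases "i \<le> k") auto
  have "rsurj f p" unfolding rsurj_def
  proof (intro conjI allI)
    show "strict_mono p"
    proof (rule strict_mono_Suc_iff[THEN iffD2, rule_format])
      fix i show "p i < p (Suc i)"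
        using p_eq[of i "Suc i"] p_eq[of "Suc i" "Suc i"] E_mono[OF R] by (simp add: strict_mono_less)
    qed
    show "f (p i) = i" for i
    proof -
      have "p i = cm (\<B> (Suc i)) i" by (rule p_eq) simp
      moreover have "cm (\<B> (Suc i)) i < cm (\<B> (Suc i)) (d + Suc i)" using E_mono[OF R] by (simp add: strict_mono_less)
      ultimately show ?thesis using f_eq[of "p i" "Suc i"] E_eq[OF R] by simp
    qed
    show "p (f x) \<le> x" for x
    proof -
      have x: "x < cm (\<B> (Suc x)) (d + Suc x)" using ge[of "Suc x"] by simp
      have "p (f x) = cm (\<B> (Suc x)) (idx (\<B> (Suc x)) x)"
        using p_eq[of "f x" "Suc x"] f_eq[OF x] E_less[OF R x] by simp
      then show ?thesis using E_le[OF R] by simp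
    qed
  qed
  then have A: "kernel f \<in> \<R>" and iA: "idx (kernel f) = f" and cA: "cm (kernel f) = p"
    using graded_spaceI[of f p c] E_grade[OF R] by (simp_all add: p_def class_index_kernel class_min_kernel)
  have "coarser (kernel f) (\<B> k)" for k
    unfolding E_coarser_iff[OF A R]
  proof (rule subrelI)
    fix s t assume st: "(s, t) \<in> \<B> k"
    \<comment> \<open>Stage \<open>K\<close> is late enough for both points to lie in the part on
      which it agrees with the limit.\<close>
    define K where "K = max k (Suc (max s t))"
    have "(s, t) \<in> \<B> K" using sub[of k K] st K_def by auto
    moreover have "s < cm (\<B> K) (d + K)" "t < cm (\<B> K) (d + K)" using ge[of K] unfolding K_def by linarith+
    ultimately show "(s, t) \<in> kernel f" using E_mem[OF R] f_eq by simp
  qed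
  moreover have "approx (d + k) (kernel f) = approx (d + k) (\<B> k)" for k
    unfolding approx_eq_iff[OF A R] iA cA using p_eq f_eq by simp
  ultimately show ?thesis using A by blast
qed

lemma finite_approximation_space_graded: "finite_approximation_space \<R> depth"
proof
  show "coarser A A" if asm: "A \<in> \<R>" for A using asm E_coarser_iff by blast
  show "coarser A C" if asm: "A \<in> \<R>" "B \<in> \<R>" "C \<in> \<R>" "coarser A B" "coarser B C" for A B C
    using asm E_coarser_iff by blast
  show "m = n \<and> (\<forall>k\<le>n. approx k A = approx k B)" if asm: "A \<in> \<R>" "B \<in> \<R>" "approx m A = approx n B" for A B m n
    using approx_eqD asm .
  show "depth B (approx n A) < depth B (approx (Suc n) A)" if asm: "A \<in> \<R>" "B \<in> \<R>" "coarser A B" for A B n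
  proof -
    obtain g q where "graded g q" "cm A = cm B \<circ> q" using coarser_factor[OF asm] by blast
    then show ?thesis using graded_mono E_eq[OF asm(2)] by (simp add: depth_approx[OF asm(1)] strict_mono_less)
  qed
  show "depth B (approx n A) \<le> depth C (approx n A)"
    if asm: "A \<in> \<R>" "B \<in> \<R>" "C \<in> \<R>" "coarser A B" "coarser B C" for A B C n
  proof -
    obtain g q where "graded g q" "cm A = cm B \<circ> q" using coarser_factor[OF asm(1,2,4)] by blast
    moreover obtain h r where "graded h r" "cm B = cm C \<circ> r" using coarser_factor[OF asm(2,3,5)] by blast
    ultimately show ?thesis using E_eq[OF asm(2)] E_eq[OF asm(3)] strict_mono_imp_increasing[OF graded_mono]
      by (metis comp_apply depth_approx[OF asm(1)])
  qed
  show "depth C (approx n A) = d"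
    if asm: "A \<in> \<R>" "B \<in> \<R>" "C \<in> \<R>" "coarser A B" "coarser B C" "approx d B = approx d C"
      "depth B (approx n A) = d" for A B C d n
  proof -
    obtain g q where "graded g q" "cm A = cm B \<circ> q" using coarser_factor[OF asm(1,2,4)] by blast
    moreover have "cm B d = cm C d" using asm(6) unfolding approx_eq_iff[OF asm(2,3)] by blast
    ultimately show ?thesis using asm(7) E_eq[OF asm(2)] E_eq[OF asm(3)]
      by (metis comp_apply depth_approx[OF asm(1)])
  qed
  show "finite {approx n A |n A. A \<in> \<R> \<and> coarser A B \<and> depth B (approx n A) = d}" if B: "B \<in> \<R>" for B d
  proof (rule finite_subset)
    \<comment> \<open>An approximation of depth \<open>d\<close> in \<open>B\<close> is a relation
      on \<open>{..<cm B d}\<close>.\<close>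
    show "finite (Pow ({..<cm B d} \<times> {..<cm B d}))" by simp
    show "{approx n A |n A. A \<in> \<R> \<and> coarser A B \<and> depth B (approx n A) = d} \<subseteq> Pow ({..<cm B d} \<times> {..<cm B d})"
    proof (clarify)
      fix x1 x2 n A assume A: "A \<in> \<R>" "coarser A B" and x: "(x1, x2) \<in> approx n A"
      obtain g q where "graded g q" "cm A = cm B \<circ> q" using coarser_factor[OF A(1) B A(2)] by blast
      then have "cm A n = cm B (depth B (approx n A))" using E_eq[OF B] by (simp add: depth_approx[OF A(1)])
      then show "x1 \<in> {..<cm B (depth B (approx n A))} \<and> x2 \<in> {..<cm B (depth B (approx n A))}"
        using x unfolding approx_def by simp
    qed
  qed
  show "depth A (approx n X) = d \<and> basic_set \<R> (approx n X) A \<noteq> {}"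
    if asm: "A \<in> \<R>" "B \<in> \<R>" "X \<in> \<R>" "coarser A B" "coarser X B" "depth B (approx n X) = d"
      "approx d A = approx d B" for A B X d n
  proof -
    obtain g q where g: "graded g q" and iX: "idx X = g \<circ> idx B" and cX: "cm X = cm B \<circ> q"
      using coarser_factor[OF asm(3,2,5)] by blast
    have qn: "q n = d" using asm(6) cX E_eq[OF asm(2)] by (simp add: depth_approx[OF asm(3)])
    \<comment> \<open>The coding of \<open>X\<close> over \<open>B\<close> is transferred to
      \<open>A\<close>. Since \<open>A\<close> and \<open>B\<close> agree up to
      \<open>d = q n\<close>, the first \<open>n\<close> levels do not change.\<close>
    let ?Y = "pull g A"
    have Y: "?Y \<in> \<R>" "coarser ?Y A" using pull_space[OF asm(1) g] pull_coarser[OF asm(1) g] .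
    have e: "cm A d = cm B d" "\<forall>x < cm B d. idx A x = idx B x"
      using asm(7) unfolding approx_eq_iff[OF asm(1,2)] by blast+
    have "approx n ?Y = approx n X"
      unfolding approx_eq_iff[OF Y(1) asm(3)] idx_pull[OF asm(1) g] cm_pull[OF asm(1) g] iX cX
      using qn e by simp
    moreover have "depth A (approx n ?Y) = d"
      unfolding depth_approx[OF Y(1)] cm_pull[OF asm(1) g] using qn E_eq[OF asm(1)] by simp
    ultimately show ?thesis using Y unfolding basic_set_def by auto
  qed
qed (rule graded_refinement graded_pigeonhole graded_fusion; assumption)+

end

lemma E_infinity_eq_graded_space:
  assumes "\<And>x n. x \<in> P n \<longleftrightarrow> c x = n"
  shows "E_infinity P = graded_space c"
  unfolding E_infinity_def graded_space_def using assms by auto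

theorem theorem5p1:
  fixes P :: "nat \<Rightarrow> nat set"
  assumes "partition_on UNIV (range P)"
    and "\<And>n. infinite (P n)"
    and "\<And>i j. i < j \<Longrightarrow> (LEAST x. x \<in> P i) < (LEAST x. x \<in> P j)"
  shows "topological_ramsey_space (E_infinity P)"
proof -
  \<comment> \<open>The partition hypothesis speaks of the set \<open>range P\<close>; the order of
    the minima separates the indices.\<close>
  have inj: "i = j" if "P i = P j" for i j
    using assms(3)[of i j] assms(3)[of j i] that by (metis less_irrefl linorder_less_linear)
  define c where "c x = (THE n. x \<in> P n)" for x
  have "\<exists>!n. x \<in> P n" for x
  proof -
    obtain n where "x \<in> P n" using partition_onD1[OF assms(1)] by auto
    moreover have "i = j" if "x \<in> P i" "x \<in> P j" for i j
      using partition_onD2[OF assms(1)] that inj by (metis disjointD disjoint_iff rangeI)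
    ultimately show ?thesis by blast
  qed
  then have "x \<in> P n \<longleftrightarrow> c x = n" for x n
    unfolding c_def by (metis (mono_tags, lifting) theI')
  then have "E_infinity P = graded_space c" by (rule E_infinity_eq_graded_space)
  then show ?thesis
    using finite_approximation_space.topological_ramsey[OF finite_approximation_space_graded] by simp
qed

end
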